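(* Let $t\mapsto(\lambda(t),\gamma(t))$ be a smooth path with velocities $(\dot\lambda,\dot\gamma)$, and let $t\mapsto\theta(t)$ be a smooth path with $\theta(t)\in\Theta_{\lambda(t),\gamma(t)}$. Assume that along the path $A=\nabla_\theta^2J$ is invertible and that $$\frac{d}{dt}\nabla_\theta J=0\quad\text{(quasi-static condition)},\qquad\frac{d}{dt}C=0\quad\text{(iso-classification condition)}.$$ Then $$0=C_\lambda\dot\lambda+C_\gamma\dot\gamma,\qquad\dot\theta=\theta_\lambda\dot\lambda+\theta_\gamma\dot\gamma,$$ where $\theta_\lambda=-A^{-1}\frac{\partial}{\partial\lambda}\nabla_\theta J$, $\theta_\gamma=-A^{-1}\frac{\partial}{\partial\gamma}\nabla_\theta J$, and, with $\ell=\log c_\theta(y_x|z)$, $$C_\lambda=-\mathbb{E}_{x\sim p(x)}\Big[\Big\langle\frac{\partial H}{\partial\lambda}\Big\rangle\langle\ell\rangle-\Big\langle\frac{\partial H}{\partial\lambda}\,\ell\Big\rangle+\langle\theta_\lambda^\top\nabla_\theta H\rangle\langle\ell\rangle-\langle\ell\,\theta_\lambda^\top\nabla_\theta H\rangle+\langle\theta_\lambda^\top\nabla_\theta\ell\rangle\Big],$$ $$C_\gamma=-\mathbb{E}_{x\sim p(x)}\Big[\Big\langle\frac{\partial H}{\partial\gamma}\Big\rangle\langle\ell\rangle-\Big\langle\frac{\partial H}{\partial\gamma}\,\ell\Big\rangle+\langle\theta_\gamma^\top\nabla_\theta H\rangle\langle\ell\rangle-\langle\ell\,\theta_\gamma^\top\nabla_\theta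 H\rangle+\langle\theta_\gamma^\top\nabla_\theta\ell\rangle\Big].$$
   Context: Data $x$ have distribution $p(x)$, and each $x$ has a deterministic true label $y_x$. For parameters $\theta\in\Theta\subseteq\mathbb{R}^N$ there are a density $m_\theta(z)$ on latent codes $z$, a decoder density $d_\theta(x|z)$ and a classifier $c_\theta(y|z)$, all positive and smooth in $\theta$. The Hamiltonian is $$H(z;x,\theta,\lambda,\gamma)=-\log m_\theta(z)-\lambda\log d_\theta(x|z)-\gamma\log c_\theta(y_x|z).$$ The normalization constant is $Z_{\theta,x}=\int e^{-H}\,dz$, assumed finite. Define $J(\theta,\lambda,\gamma)=-\mathbb{E}_{x\sim p(x)}[\log Z_{\theta,x}]$, $F(\lambda,\gamma)=\min_{\theta\in\Theta}J(\theta,\lambda,\gamma)$, and the equilibrium set $\Theta_{\lambda,\gamma}=\{\theta\in\Theta: J(\theta,\lambda,\gamma)=F(\lambda,\gamma)\}$; on it $\nabla_\theta J=0$. For fixed $x$, $\langle\varphi\rangle=\int\varphi\,e^{-H}dz\big/\int e^{-H}dz$ is the Gibbs average over $z$, which is the average under the optimal encoder $e(z|x)=e^{-H}/Z_{\theta,x}$. The classification loss is $C=C(\theta,\lambda,\gamma)=\mathbb{E}_{x\sim p(x)}\big[-\int e(z|x)\log c_\theta(y_x|z)\,dz\big]=-\mathbb{E}_{x\sim p(x)}\langle\ell\rangle$. Enough regularity and integrability is assumed to differentiate under the integrals over $z$ and $x$. *)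

theory Defs
  imports "HOL-Probability.Probability"
begin

text \<open>
  Infinite differentiability on an open set: all iterated directional derivatives exist,
  the intermediate ones are Frechet differentiable, and all are continuous.
\<close>

fun C_k_on :: "nat \<Rightarrow> 'a::euclidean_space set \<Rightarrow> ('a \<Rightarrow> 'b::real_normed_vector) \<Rightarrow> bool" where
  "C_k_on 0 S f \<longleftrightarrow> continuous_on S f"
| "C_k_on (Suc k) S f \<longleftrightarrow> (\<forall>x\<in>S. f differentiable (at x)) \<and>
     (\<forall>v. C_k_on k S (\<lambda>x. frechet_derivative f (at x) v))"

definition smooth_on :: "'a::euclidean_space set \<Rightarrow> ('a \<Rightarrow> 'b::real_normed_vector) \<Rightarrow> bool" where
  "smooth_on S f \<longleftrightarrow> (\<forall>k. C_k_on k S f)"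

definition grad :: "(real^'n \<Rightarrow> real) \<Rightarrow> real^'n \<Rightarrow> real^'n" where
  "grad f \<theta> = (\<chi> i. frechet_derivative f (at \<theta>) (axis i 1))"

text \<open>
  The usual hypothesis for differentiating \<open>\<integral> f q s d\<mu>(s)\<close> up to \<open>k\<close> times in the parameter \<open>q\<close>:
  locally uniformly in \<open>q\<close>, the integrand and its directional derivatives of order at most \<open>k\<close>
  are dominated by integrable functions.
\<close>

definition locally_dominated ::
    "'s measure \<Rightarrow> 'q::euclidean_space set \<Rightarrow> ('q \<Rightarrow> 's \<Rightarrow> real) \<Rightarrow> bool" where
  "locally_dominated \<mu> Q f \<longleftrightarrow>
     (\<forall>q\<^sub>0\<in>Q. \<exists>V g. open V \<and> q\<^sub>0 \<in> V \<and> integrable \<mu> g \<and>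
        (AE s in \<mu>. \<forall>q\<in>V \<inter> Q. \<bar>f q s\<bar> \<le> g s))"

fun dominated_derivs ::
    "nat \<Rightarrow> 's measure \<Rightarrow> 'q::euclidean_space set \<Rightarrow> ('q \<Rightarrow> 's \<Rightarrow> real) \<Rightarrow> bool" where
  "dominated_derivs 0 \<mu> Q f \<longleftrightarrow> locally_dominated \<mu> Q f"
| "dominated_derivs (Suc k) \<mu> Q f \<longleftrightarrow> locally_dominated \<mu> Q f \<and>
     (\<forall>v. dominated_derivs k \<mu> Q (\<lambda>q s. frechet_derivative (\<lambda>q'. f q' s) (at q) v))"

text \<open>
  \<open>data_ref\<close> and \<open>latent\<close> are the reference measures \<open>dx\<close> and \<open>dz\<close>; \<open>data\<close> is the
  distribution of \<open>x\<close>; \<open>label x\<close> is \<open>y\<^sub>x\<close>. The arguments of the three densities are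
  ordered as in \<open>m\<^sub>\<theta>(z)\<close>, \<open>d\<^sub>\<theta>(x|z)\<close> and \<open>c\<^sub>\<theta>(y|z)\<close>.
\<close>

record ('x, 'y, 'z, 'n) latent_model =
  data_ref :: "'x measure"
  data :: "'x measure"
  label :: "'x \<Rightarrow> 'y"
  latent :: "'z measure"
  params :: "(real^'n) set"
  prior :: "real^'n \<Rightarrow> 'z \<Rightarrow> real"
  decoder :: "real^'n \<Rightarrow> 'x \<Rightarrow> 'z \<Rightarrow> real"
  classifier :: "real^'n \<Rightarrow> 'y \<Rightarrow> 'z \<Rightarrow> real"

definition log_class :: "('x,'y,'z,'n::finite) latent_model \<Rightarrow> 'z \<Rightarrow> 'x \<Rightarrow> real^'n \<Rightarrow> real" where
  "log_class M z x \<theta> = ln (classifier M \<theta> (label M x) z)"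

definition hamiltonian ::
    "('x,'y,'z,'n::finite) latent_model \<Rightarrow> 'z \<Rightarrow> 'x \<Rightarrow> real^'n \<Rightarrow> real \<Rightarrow> real \<Rightarrow> real" where
  "hamiltonian M z x \<theta> l g =
     - ln (prior M \<theta> z) - l * ln (decoder M \<theta> x z) - g * ln (classifier M \<theta> (label M x) z)"

definition norm_const ::
    "('x,'y,'z,'n::finite) latent_model \<Rightarrow> 'x \<Rightarrow> real^'n \<Rightarrow> real \<Rightarrow> real \<Rightarrow> real" where
  "norm_const M x \<theta> l g = (\<integral>z. exp (- hamiltonian M z x \<theta> l g) \<partial>latent M)"

definition J_fun ::
    "('x,'y,'z,'n::finite) latent_model \<Rightarrow> real^'n \<Rightarrow> real \<Rightarrow> real \<Rightarrow> real" where
  "J_fun M \<theta> l g = - (\<integral>x. ln (norm_const M x \<theta> l g) \<partial>data M)"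

text \<open>\<open>LEAST\<close> is the minimum of the set of values whenever that minimum is attained.\<close>

definition F_fun :: "('x,'y,'z,'n::finite) latent_model \<Rightarrow> real \<Rightarrow> real \<Rightarrow> real" where
  "F_fun M l g = (LEAST v. v \<in> (\<lambda>\<theta>. J_fun M \<theta> l g) ` params M)"

definition equilibrium ::
    "('x,'y,'z,'n::finite) latent_model \<Rightarrow> real \<Rightarrow> real \<Rightarrow> (real^'n) set" where
  "equilibrium M l g = {\<theta> \<in> params M. J_fun M \<theta> l g = F_fun M l g}"

definition encoder ::
    "('x,'y,'z,'n::finite) latent_model \<Rightarrow> real^'n \<Rightarrow> real \<Rightarrow> real \<Rightarrow> 'z \<Rightarrow> 'x \<Rightarrow> real" where
  "encoder M \<theta> l g z x = exp (- hamiltonian M z x \<theta> l g) / norm_const M x \<theta> l g"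

definition gibbs ::
    "('x,'y,'z,'n::finite) latent_model \<Rightarrow> 'x \<Rightarrow> real^'n \<Rightarrow> real \<Rightarrow> real \<Rightarrow> ('z \<Rightarrow> real) \<Rightarrow> real" where
  "gibbs M x \<theta> l g \<phi> =
     (\<integral>z. \<phi> z * exp (- hamiltonian M z x \<theta> l g) \<partial>latent M) /
     (\<integral>z. exp (- hamiltonian M z x \<theta> l g) \<partial>latent M)"

definition class_loss ::
    "('x,'y,'z,'n::finite) latent_model \<Rightarrow> real^'n \<Rightarrow> real \<Rightarrow> real \<Rightarrow> real" where
  "class_loss M \<theta> l g =
     (\<integral>x. - (\<integral>z. encoder M \<theta> l g z x * ln (classifier M \<theta> (label M x) z) \<partial>latent M) \<partial>data M)"

definition grad_J ::
    "('x,'y,'z,'n::finite) latent_model \<Rightarrow> real^'n \<Rightarrow> real \<Rightarrow> real \<Rightarrow> real^'n" where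
  "grad_J M \<theta> l g = grad (\<lambda>\<theta>'. J_fun M \<theta>' l g) \<theta>"

definition hess_J ::
    "('x,'y,'z,'n::finite) latent_model \<Rightarrow> real^'n \<Rightarrow> real \<Rightarrow> real \<Rightarrow> real^'n^'n" where
  "hess_J M \<theta> l g = jacobian (\<lambda>\<theta>'. grad_J M \<theta>' l g) (at \<theta>)"

definition theta_lam ::
    "('x,'y,'z,'n::finite) latent_model \<Rightarrow> real^'n \<Rightarrow> real \<Rightarrow> real \<Rightarrow> real^'n" where
  "theta_lam M \<theta> l g =
     - (matrix_inv (hess_J M \<theta> l g) *v vector_derivative (\<lambda>l'. grad_J M \<theta> l' g) (at l))"

definition theta_gam ::
    "('x,'y,'z,'n::finite) latent_model \<Rightarrow> real^'n \<Rightarrow> real \<Rightarrow> real \<Rightarrow> real^'n" where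
  "theta_gam M \<theta> l g =
     - (matrix_inv (hess_J M \<theta> l g) *v vector_derivative (\<lambda>g'. grad_J M \<theta> l g') (at g))"

text \<open>
  The common shape of the two coefficients: \<open>dH z x\<close> is the partial derivative of the Hamiltonian
  in the varied multiplier and \<open>w\<close> the corresponding velocity of the parameter.
\<close>

definition loss_coeff ::
    "('x,'y,'z,'n::finite) latent_model \<Rightarrow> real^'n \<Rightarrow> real \<Rightarrow> real \<Rightarrow> ('z \<Rightarrow> 'x \<Rightarrow> real) \<Rightarrow> real^'n \<Rightarrow> real" where
  "loss_coeff M \<theta> l g dH w =
     - (\<integral>x. (let avg = gibbs M x \<theta> l g;
                 ell = (\<lambda>z. log_class M z x \<theta>);
                 gH = (\<lambda>z. grad (\<lambda>\<theta>'. hamiltonian M z x \<theta>' l g) \<theta>);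
                 gell = (\<lambda>z. grad (\<lambda>\<theta>'. log_class M z x \<theta>') \<theta>)
             in avg (\<lambda>z. dH z x) * avg ell
                - avg (\<lambda>z. dH z x * ell z)
                + avg (\<lambda>z. w \<bullet> gH z) * avg ell
                - avg (\<lambda>z. ell z * (w \<bullet> gH z))
                + avg (\<lambda>z. w \<bullet> gell z)) \<partial>data M)"

definition C_lam ::
    "('x,'y,'z,'n::finite) latent_model \<Rightarrow> real^'n \<Rightarrow> real \<Rightarrow> real \<Rightarrow> real" where
  "C_lam M \<theta> l g =
     loss_coeff M \<theta> l g (\<lambda>z x. deriv (\<lambda>l'. hamiltonian M z x \<theta> l' g) l) (theta_lam M \<theta> l g)"

definition C_gam ::
    "('x,'y,'z,'n::finite) latent_model \<Rightarrow> real^'n \<Rightarrow> real \<Rightarrow> real \<Rightarrow> real" where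
  "C_gam M \<theta> l g =
     loss_coeff M \<theta> l g (\<lambda>z x. deriv (\<lambda>g'. hamiltonian M z x \<theta> l g') g) (theta_gam M \<theta> l g)"

text \<open>
  \<open>U\<close> is an open neighbourhood of the parameter set on which the three functions are positive and
  smooth in \<open>\<theta>\<close> (take \<open>U = params M\<close> if the latter is open), so that derivatives in \<open>\<theta>\<close> make
  sense; they are required to be normalised densities on the parameter set only.
\<close>

definition density_model :: "('x,'y,'z,'n::finite) latent_model \<Rightarrow> (real^'n) set \<Rightarrow> bool" where
  "density_model M U \<longleftrightarrow>
     sigma_finite_measure (data_ref M) \<and> sigma_finite_measure (latent M) \<and>
     prob_space (data M) \<and> sets (data M) = sets (data_ref M) \<and>
     label M \<in> measurable (data M) (count_space UNIV) \<and>
     open U \<and> params M \<subseteq> U \<and>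
     (\<forall>\<theta>\<in>U.
        prior M \<theta> \<in> borel_measurable (latent M) \<and>
        (\<lambda>(x, z). decoder M \<theta> x z) \<in> borel_measurable (data_ref M \<Otimes>\<^sub>M latent M) \<and>
        (\<forall>y. classifier M \<theta> y \<in> borel_measurable (latent M))) \<and>
     (\<forall>\<theta>\<in>params M.
        (\<integral>\<^sup>+z. ennreal (prior M \<theta> z) \<partial>latent M) = 1 \<and>
        (\<forall>z\<in>space (latent M).
           (\<integral>\<^sup>+x. ennreal (decoder M \<theta> x z) \<partial>data_ref M) = 1 \<and>
           ((\<lambda>y. classifier M \<theta> y z) has_sum 1) UNIV)) \<and>
     (\<forall>z\<in>space (latent M).
        (\<forall>\<theta>\<in>U. prior M \<theta> z > 0) \<and> smooth_on U (\<lambda>\<theta>. prior M \<theta> z) \<and>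
        (\<forall>x\<in>space (data M).
           (\<forall>\<theta>\<in>U. decoder M \<theta> x z > 0) \<and> smooth_on U (\<lambda>\<theta>. decoder M \<theta> x z)) \<and>
        (\<forall>y. (\<forall>\<theta>\<in>U. classifier M \<theta> y z > 0) \<and> smooth_on U (\<lambda>\<theta>. classifier M \<theta> y z)))"

text \<open>
  \<open>W\<close> is the open set of multipliers \<open>(\<lambda>, \<gamma>)\<close> under consideration. Domination is required in the
  joint parameter \<open>(\<theta>, \<lambda>, \<gamma>)\<close>, up to second order. No separate hypothesis is needed for the
  classification loss, since \<open>\<partial>(e\<^sup>-\<^sup>H)/\<partial>\<gamma> = \<ell> e\<^sup>-\<^sup>H\<close> and hence \<open>\<partial>(log Z)/\<partial>\<gamma> = \<langle>\<ell>\<rangle>\<close>. The last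
  condition makes the averages of \<open>\<nabla>\<ell>\<close> and (given the domination) of \<open>\<ell> \<nabla>H\<close> converge separately.
\<close>

definition regular_model ::
    "('x,'y,'z,'n::finite) latent_model \<Rightarrow> (real^'n) set \<Rightarrow> (real \<times> real) set \<Rightarrow> bool" where
  "regular_model M U W \<longleftrightarrow>
     open W \<and>
     (\<forall>x\<in>space (data M). \<forall>\<theta>\<in>U. \<forall>(l, g)\<in>W.
        integrable (latent M) (\<lambda>z. exp (- hamiltonian M z x \<theta> l g))) \<and>
     (\<forall>x\<in>space (data M).
        dominated_derivs 2 (latent M) (U \<times> W)
          (\<lambda>(\<theta>, l, g) z. exp (- hamiltonian M z x \<theta> l g))) \<and>
     dominated_derivs 2 (data M) (U \<times> W)
       (\<lambda>(\<theta>, l, g) x. ln (norm_const M x \<theta> l g)) \<and>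
     (\<forall>x\<in>space (data M). \<forall>\<theta>\<in>U. \<forall>(l, g)\<in>W.
        integrable (latent M)
          (\<lambda>z. exp (- hamiltonian M z x \<theta> l g) *\<^sub>R grad (\<lambda>\<theta>'. log_class M z x \<theta>') \<theta>))"

definition equilibrium_model ::
    "('x,'y,'z,'n::finite) latent_model \<Rightarrow> (real \<times> real) set \<Rightarrow> bool" where
  "equilibrium_model M W \<longleftrightarrow>
     (\<forall>(l, g)\<in>W.
        (\<exists>\<theta>\<in>params M. \<forall>\<theta>'\<in>params M. J_fun M \<theta> l g \<le> J_fun M \<theta>' l g) \<and>
        (\<forall>\<theta>\<in>equilibrium M l g. grad_J M \<theta> l g = 0))"

end

(*
  Put K(\<theta>, \<lambda>, \<gamma>) = E_x[log Z], so that J = - K. Because \<ell> e^(-H) is the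
      \<gamma>-derivative of e^(-H),
  the classification loss is C = - \<partial>K/\<partial>\<gamma>. Domination up to second order lets both integrals
  be differentiated twice, so \<nabla>J and C are differentiable jointly in (\<theta>, \<lambda>, \<gamma>).
      The chain rule
  applied to \<nabla>J along the path gives the velocity of \<theta>; applied to C it gives
  0 = \<lambda>' DC(\<theta>_\<lambda>, 1, 0) + \<gamma>' DC(\<theta>_\<gamma>, 0, 1), and expanding
      D(\<partial>(log Z)/\<partial>\<gamma>) = D\<langle>\<ell>\<rangle> into
  Gibbs averages identifies these two derivatives with the coefficients C_\<lambda> and C_\<gamma>.
*)

theory Submission
  imports Defs
begin

section \<open>Differentiation under the integral sign\<close>

text \<open>The domination hypothesis is stated one direction at a time, with a neighbourhood and a
  bound depending on the direction, whereas a Frechet derivative must be controlled in all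
  directions at once; finite dimension closes this gap. All derivatives are taken in the joint
  variable (\<theta>, \<lambda>, \<gamma>), and mixed derivatives of K always in a fixed direction
  first (a coordinate axis of \<theta> for the gradient of J, the \<gamma> axis for C) and in the
  direction of motion second. The delicate point of the expansion into averages is that the second
  derivatives of e^(-H) control \<ell> grad H and grad \<ell> only through a combination of the two;
  the integrability of e^(-H) grad \<ell> is what splits it into two convergent averages. Dividing
  by Z and taking its logarithm also requires Z > 0, which rests on the existence of a normalised
  prior.\<close>

lemma locally_dominated_frechet_uniform:
  fixes f :: "'q::euclidean_space \<Rightarrow> 's \<Rightarrow> real"
  assumes Q: "open Q" "q\<^sub>0 \<in> Q"
    and diff: "\<And>q s. q \<in> Q \<Longrightarrow> s \<in> space \<mu> \<Longrightarrow> (\<lambda>q. f q s)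
        differentiable (at q)"
    and dom: "\<And>v. locally_dominated \<mu> Q (\<lambda>q s. frechet_derivative (\<lambda>q'. f q' s) (at q) v)"
  obtains r g where "r > 0" "ball q\<^sub>0 r \<subseteq> Q" "integrable \<mu> g"
    "AE s in \<mu>. \<forall>q\<in>ball q\<^sub>0 r. \<forall>v. \<bar>frechet_derivative (\<lambda>q'. f q' s)
        (at q) v\<bar> \<le> g s * norm v"
proof -
  let ?D = "\<lambda>q s. frechet_derivative (\<lambda>q'. f q' s) (at q)"
  have "\<exists>V g. open V \<and> q\<^sub>0 \<in> V \<and> integrable \<mu> g \<and> (AE s in \<mu>.
      \<forall>q\<in>V \<inter> Q. \<bar>?D q s b\<bar> \<le> g s)" for b
    using dom[of b] Q(2) unfolding locally_dominated_def by (rule bspec)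
  \<comment> \<open>Neighbourhood and bound are paired so that one application of choice selects
    both for every direction.\<close>
  then have "\<forall>b. \<exists>Vg. open (fst Vg) \<and> q\<^sub>0 \<in> fst Vg \<and> integrable \<mu> (snd
      Vg) \<and>
      (AE s in \<mu>. \<forall>q\<in>fst Vg \<inter> Q. \<bar>?D q s b\<bar> \<le> snd Vg s)"
    by (simp only: split_paired_Ex fst_conv snd_conv simp_thms)
  then obtain Vg where Vg: "\<forall>b. open (fst (Vg b)) \<and> q\<^sub>0 \<in> fst (Vg b) \<and> integrable
      \<mu> (snd (Vg b)) \<and>
      (AE s in \<mu>. \<forall>q\<in>fst (Vg b) \<inter> Q. \<bar>?D q s b\<bar> \<le> snd (Vg b) s)"
    by (rule exE[OF choice])
  define V g where "V b = fst (Vg b)" and "g b = snd (Vg b)" for b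
  have V: "open (V b)" "q\<^sub>0 \<in> V b" "integrable \<mu> (g b)"
    and le: "AE s in \<mu>. \<forall>q\<in>V b \<inter> Q. \<bar>?D q s b\<bar> \<le> g b s" for b
    using spec[OF Vg, of b] unfolding V_def g_def by simp_all
  \<comment> \<open>Only the finitely many basis directions are used, so the intersection of their
    neighbourhoods is still open.\<close>
  have "open (Q \<inter> (\<Inter>b\<in>Basis. V b))"
    using Q V by (intro open_Int open_INT) auto
  moreover have "q\<^sub>0 \<in> Q \<inter> (\<Inter>b\<in>Basis. V b)"
    using Q V by auto
  ultimately obtain r where r: "r > 0" "ball q\<^sub>0 r \<subseteq> Q \<inter> (\<Inter>b\<in>Basis. V b)"
    by (meson openE)
  \<comment> \<open>Expanding v in the basis, with each coordinate at most \<open>norm v\<close> in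
    absolute value, turns the bounds on basis directions into a bound on the whole linear
    map.\<close>
  let ?g = "\<lambda>s. \<Sum>b\<in>Basis. g b s"
  have "AE s in \<mu>. \<forall>b\<in>Basis. \<forall>q\<in>V b \<inter> Q. \<bar>?D q s b\<bar> \<le> g b s"
    by (rule AE_finite_allI[OF finite_Basis le])
  then have "AE s in \<mu>. \<forall>q\<in>ball q\<^sub>0 r. \<forall>v. \<bar>?D q s v\<bar> \<le> ?g s * norm v"
    using AE_space
  proof eventually_elim
    case (elim s)
    show ?case
    proof (intro ballI allI)
      fix q v assume q: "q \<in> ball q\<^sub>0 r"
      then have qQ: "q \<in> Q" using r by auto
      have lin: "linear (?D q s)"
        using diff[OF qQ elim(2)] by (rule linear_frechet_derivative)
      have "?D q s v = ?D q s (\<Sum>b\<in>Basis. (v \<bullet> b) *\<^sub>R b)"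
        by (simp add: euclidean_representation)
      also have "\<dots> = (\<Sum>b\<in>Basis. (v \<bullet> b) * ?D q s b)"
        using lin by (simp add: linear_sum linear_scale)
      also have "\<bar>\<dots>\<bar> \<le> (\<Sum>b\<in>Basis. norm v * g b s)"
      proof (rule order_trans[OF sum_abs sum_mono])
        fix b :: 'q assume b: "b \<in> Basis"
        then have "q \<in> V b \<inter> Q" using q r by auto
        then have "\<bar>?D q s b\<bar> \<le> g b s" using elim b by auto
        then show "\<bar>(v \<bullet> b) * ?D q s b\<bar> \<le> norm v * g b s"
          unfolding abs_mult using b by (intro mult_mono Basis_le_norm) auto
      qed
      finally show "\<bar>?D q s v\<bar> \<le> ?g s * norm v"
        by (simp add: sum_distrib_left mult.commute)
    qed
  qed
  then show thesis
    using r V by (intro that[of r ?g]) auto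
qed

text \<open>A directional derivative is the pointwise limit of difference quotients along a fixed
  null sequence of step lengths, and each quotient is measurable in \<open>s\<close>.\<close>

lemma borel_measurable_frechet_derivative:
  fixes f :: "'q::euclidean_space \<Rightarrow> 's \<Rightarrow> real"
  assumes Q: "open Q" "q \<in> Q"
    and diff: "\<And>s. s \<in> space \<mu> \<Longrightarrow> (\<lambda>q. f q s) differentiable (at q)"
    and meas: "\<And>q. q \<in> Q \<Longrightarrow> f q \<in> borel_measurable \<mu>"
  shows "(\<lambda>s. frechet_derivative (\<lambda>q. f q s) (at q) v) \<in> borel_measurable \<mu>"
proof -
  define h :: "nat \<Rightarrow> real" where "h n = inverse (real (Suc n))" for n
  have h: "h \<longlonglongrightarrow> 0" "\<And>n. h n \<noteq> 0"
    unfolding h_def using LIMSEQ_inverse_real_of_nat by simp_all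
  have "(\<lambda>n. q + h n *\<^sub>R v) \<longlonglongrightarrow> q + 0 *\<^sub>R v"
    by (intro tendsto_intros h)
  \<comment> \<open>Measurability of \<open>f\<close> is known only at parameters in
    \<open>Q\<close>; the first \<open>N\<close> steps, which may leave \<open>Q\<close>, are
    discarded by a shift of the index.\<close>
  then have "eventually (\<lambda>n. q + h n *\<^sub>R v \<in> Q) sequentially"
    using Q topological_tendstoD by fastforce
  then obtain N where N: "\<And>n. n \<ge> N \<Longrightarrow> q + h n *\<^sub>R v \<in> Q"
    unfolding eventually_sequentially by auto
  show ?thesis
  proof (rule borel_measurable_LIMSEQ_real)
    fix s assume s: "s \<in> space \<mu>"
    let ?D = "frechet_derivative (\<lambda>q. f q s) (at q)"
    have D: "((\<lambda>q. f q s) has_derivative ?D) (at q)"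
      using diff[OF s] frechet_derivative_works by blast
    have "((\<lambda>t. q + t *\<^sub>R v) has_derivative (\<lambda>t. t *\<^sub>R v)) (at 0)"
      by (auto intro!: derivative_eq_intros)
    from has_derivative_compose[OF this, of "\<lambda>q. f q s" ?D]
    have "((\<lambda>t. f (q + t *\<^sub>R v) s) has_derivative (\<lambda>t. ?D (t *\<^sub>R v))) (at 0)"
      using D by simp
    moreover have "(\<lambda>t. ?D (t *\<^sub>R v)) = (\<lambda>t. ?D v * t)"
      using linear_frechet_derivative[OF diff[OF s]] by (auto simp: linear_scale)
    ultimately have "((\<lambda>t. f (q + t *\<^sub>R v) s) has_real_derivative ?D v) (at 0)"
      by (simp add: has_field_derivative_def)
    then have "((\<lambda>t. (f (q + t *\<^sub>R v) s - f q s) / t) \<longlongrightarrow> ?D v) (at 0)"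
      by (simp add: has_field_derivative_iff)
    then have "(\<lambda>n. (f (q + h n *\<^sub>R v) s - f q s) / h n) \<longlonglongrightarrow> ?D v"
      using h unfolding tendsto_at_iff_sequentially comp_def by auto
    then show "(\<lambda>n. (f (q + h (n + N) *\<^sub>R v) s - f q s) / h (n + N)) \<longlonglongrightarrow> ?D v"
      by (rule LIMSEQ_ignore_initial_segment)
  next
    fix n
    show "(\<lambda>s. (f (q + h (n + N) *\<^sub>R v) s - f q s) / h (n + N)) \<in> borel_measurable \<mu>"
      using meas[OF N[of "n + N"]] meas[OF Q(2)] by measurable
  qed
qed

text \<open>Dominated convergence is applied to the normalised remainder of the first-order
  expansion at \<open>q\<^sub>0\<close>. The uniform bound \<open>g\<close> on the derivative
  dominates it by \<open>2 * g\<close>: one \<open>g\<close> for the increment of \<open>f\<close>,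
  one for the linear term.\<close>

lemma
  fixes f :: "'q::euclidean_space \<Rightarrow> 's \<Rightarrow> real"
  assumes Q: "open Q" "q\<^sub>0 \<in> Q"
    and diff: "\<And>q s. q \<in> Q \<Longrightarrow> s \<in> space \<mu> \<Longrightarrow> (\<lambda>q. f q s)
        differentiable (at q)"
    and int: "\<And>q. q \<in> Q \<Longrightarrow> integrable \<mu> (f q)"
    and dom: "\<And>v. locally_dominated \<mu> Q (\<lambda>q s. frechet_derivative (\<lambda>q'. f q' s) (at q) v)"
  shows integrable_frechet_derivative:
      "integrable \<mu> (\<lambda>s. frechet_derivative (\<lambda>q. f q s) (at q\<^sub>0) v)"
    and has_derivative_integral_dominated:
      "((\<lambda>q. \<integral>s. f q s \<partial>\<mu>) has_derivative
        (\<lambda>v. \<integral>s. frechet_derivative (\<lambda>q. f q s) (at q\<^sub>0) v \<partial>\<mu>))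
            (at q\<^sub>0)"
proof -
  let ?D = "\<lambda>q s. frechet_derivative (\<lambda>q'. f q' s) (at q)"
  obtain r g where r: "r > 0" "ball q\<^sub>0 r \<subseteq> Q" and g: "integrable \<mu> g"
    and le: "AE s in \<mu>. \<forall>q\<in>ball q\<^sub>0 r. \<forall>v. \<bar>?D q s v\<bar> \<le> g s * norm v"
    by (rule locally_dominated_frechet_uniform[OF Q diff dom])
  have meas: "(\<lambda>s. ?D q\<^sub>0 s v) \<in> borel_measurable \<mu>" for v
    by (rule borel_measurable_frechet_derivative[OF Q diff[OF Q(2)] borel_measurable_integrable[OF int]])
  have intD: "integrable \<mu> (\<lambda>s. ?D q\<^sub>0 s v)" for v
  proof (rule Bochner_Integration.integrable_bound)
    show "integrable \<mu> (\<lambda>s. g s * norm v)" using g by simp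
    show "AE s in \<mu>. norm (?D q\<^sub>0 s v) \<le> norm (g s * norm v)"
      using le
    proof eventually_elim
      case (elim s)
      then have "\<bar>?D q\<^sub>0 s v\<bar> \<le> g s * norm v" using r by auto
      then show ?case by simp
    qed
  qed (rule meas)
  show "integrable \<mu> (\<lambda>s. ?D q\<^sub>0 s v)" by (rule intD)
  let ?I = "\<lambda>v. \<integral>s. ?D q\<^sub>0 s v \<partial>\<mu>"
  have lin: "linear (?D q\<^sub>0 s)" if "s \<in> space \<mu>" for s
    using diff[OF Q(2) that] by (rule linear_frechet_derivative)
  have linI: "linear ?I"
  proof (rule linearI)
    fix u v
    have "?I (u + v) = (\<integral>s. ?D q\<^sub>0 s u + ?D q\<^sub>0 s v \<partial>\<mu>)"
      by (rule Bochner_Integration.integral_cong) (auto simp: linear_add[OF lin])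
    then show "?I (u + v) = ?I u + ?I v"
      using intD by simp
  next
    fix c v
    have "?I (c *\<^sub>R v) = (\<integral>s. c * ?D q\<^sub>0 s v \<partial>\<mu>)"
      by (rule Bochner_Integration.integral_cong) (auto simp: linear_scale[OF lin])
    then show "?I (c *\<^sub>R v) = c *\<^sub>R ?I v"
      by simp
  qed
  \<comment> \<open>At \<open>q = q\<^sub>0\<close> the convention for division by zero gives the
    value 0, so the bound below holds on the whole ball.\<close>
  define R where "R q s = (f q s - f q\<^sub>0 s - ?D q\<^sub>0 s (q - q\<^sub>0)) / norm (q - q\<^sub>0)" for q s
  have R_int: "integrable \<mu> (R q)" if "q \<in> Q" for q
    unfolding R_def using int[OF that] int[OF Q(2)] intD by auto
  have R_eq: "(\<integral>s. R q s \<partial>\<mu>)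
      = ((\<integral>s. f q s \<partial>\<mu>) - (\<integral>s. f q\<^sub>0 s \<partial>\<mu>) - ?I (q -
          q\<^sub>0)) / norm (q - q\<^sub>0)" if "q \<in> Q" for q
    unfolding R_def using int[OF that] int[OF Q(2)] intD by simp
  have R_bound: "AE s in \<mu>. \<forall>q\<in>ball q\<^sub>0 r. \<bar>R q s\<bar> \<le> 2 * g s"
    using le AE_space
  proof eventually_elim
    case (elim s)
    \<comment> \<open>Nonnegativity of \<open>g\<close> follows from its bound on the derivative in
      a single direction of norm 1.\<close>
    have g0: "0 \<le> g s"
    proof -
      obtain b :: 'q where b: "b \<in> Basis" using nonempty_Basis by blast
      have "\<bar>?D q\<^sub>0 s b\<bar> \<le> g s * norm b" using elim(1) r(1) by auto
      then show ?thesis using b by simp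
    qed
    show ?case
    proof
      fix q assume q: "q \<in> ball q\<^sub>0 r"
      \<comment> \<open>Mean value inequality on the convex ball, where \<open>g s\<close> bounds
        the operator norm of the derivative.\<close>
      have "norm (f q s - f q\<^sub>0 s) \<le> g s * norm (q - q\<^sub>0)"
      proof (rule differentiable_bound[of "ball q\<^sub>0 r" "\<lambda>q. f q s" "\<lambda>q. ?D q s"])
        fix p assume p: "p \<in> ball q\<^sub>0 r"
        show "((\<lambda>q. f q s) has_derivative ?D p s) (at p within ball q\<^sub>0 r)"
          using diff[OF subsetD[OF r(2) p] elim(2)] unfolding frechet_derivative_works
          by (rule has_derivative_at_withinI)
        show "onorm (?D p s) \<le> g s"
          using elim(1) p g0 by (intro onorm_bound) auto
      qed (use q r in auto)
      moreover have "\<bar>?D q\<^sub>0 s (q - q\<^sub>0)\<bar> \<le> g s * norm (q - q\<^sub>0)"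
        using elim(1) r by auto
      ultimately have "\<bar>f q s - f q\<^sub>0 s - ?D q\<^sub>0 s (q - q\<^sub>0)\<bar> \<le> 2 * g s * norm
          (q - q\<^sub>0)"
        by simp
      then show "\<bar>R q s\<bar> \<le> 2 * g s"
        unfolding R_def using g0 by (cases "q = q\<^sub>0") (auto simp: field_simps)
    qed
  qed
  \<comment> \<open>The limit is tested along sequences, which is the form of dominated convergence;
    the tail from \<open>N\<close> on stays in the ball where the bound holds.\<close>
  have "((\<lambda>q. \<integral>s. R q s \<partial>\<mu>) \<longlongrightarrow> 0) (at q\<^sub>0)"
    unfolding tendsto_at_iff_sequentially comp_def
  proof (intro allI impI)
    fix X assume X: "\<forall>i::nat. X i \<in> UNIV - {q\<^sub>0}" "X \<longlonglongrightarrow> q\<^sub>0"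
    have "eventually (\<lambda>n. X n \<in> ball q\<^sub>0 r) sequentially"
      using r(1) by (intro topological_tendstoD[OF X(2)]) auto
    then obtain N where N: "\<And>n. n \<ge> N \<Longrightarrow> X n \<in> ball q\<^sub>0 r"
      unfolding eventually_sequentially by auto
    have "(\<lambda>n. \<integral>s. R (X (n + N)) s \<partial>\<mu>) \<longlonglongrightarrow> (\<integral>s.
        0 \<partial>\<mu>)"
    proof (rule integral_dominated_convergence)
      show "integrable \<mu> (\<lambda>s. 2 * g s)" using g by simp
      show "R (X (n + N)) \<in> borel_measurable \<mu>" for n
        by (rule borel_measurable_integrable[OF R_int[OF subsetD[OF r(2) N]]]) simp
      show "AE s in \<mu>. (\<lambda>n. R (X (n + N)) s) \<longlonglongrightarrow> 0"
        using AE_space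
      proof eventually_elim
        case (elim s)
        have "((\<lambda>q. f q s) has_derivative ?D q\<^sub>0 s) (at q\<^sub>0)"
          using diff[OF Q(2) elim] frechet_derivative_works by blast
        then have "((\<lambda>q. R q s) \<longlongrightarrow> 0) (at q\<^sub>0)"
          unfolding R_def has_derivative_at_within by (simp add: divide_inverse mult.commute)
        then have "(\<lambda>n. R (X n) s) \<longlonglongrightarrow> 0"
          using X unfolding tendsto_at_iff_sequentially comp_def by auto
        then show ?case by (rule LIMSEQ_ignore_initial_segment)
      qed
      show "AE s in \<mu>. norm (R (X (n + N)) s) \<le> 2 * g s" for n
        using R_bound by eventually_elim (use N in auto)
    qed simp
    then show "(\<lambda>n. \<integral>s. R (X n) s \<partial>\<mu>) \<longlonglongrightarrow> 0"
      by (simp add: LIMSEQ_offset)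
  qed
  then have "((\<lambda>q. ((\<integral>s. f q s \<partial>\<mu>) - (\<integral>s. f q\<^sub>0 s
      \<partial>\<mu>) - ?I (q - q\<^sub>0)) / norm (q - q\<^sub>0)) \<longlongrightarrow> 0) (at q\<^sub>0)"
    by (rule Lim_transform_within_open[OF _ Q]) (use R_eq in auto)
  then show "((\<lambda>q. \<integral>s. f q s \<partial>\<mu>) has_derivative ?I) (at q\<^sub>0)"
    using linI unfolding has_derivative_at_within linear_conv_bounded_linear by (simp add: divide_inverse
        mult.commute)
qed

section \<open>Twice differentiable functions\<close>

text \<open>Second order is expressed through the real-valued functions obtained by fixing a
  direction \<open>v\<close>. This matches \<open>C_k_on\<close> and
  \<open>dominated_derivs\<close>, and lets the theorem on integrals of real functions be applied
  again to each first derivative.\<close>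

definition twice_differentiable_on :: "'q::euclidean_space set \<Rightarrow> ('q \<Rightarrow> real)
    \<Rightarrow> bool" where
  "twice_differentiable_on Q f \<longleftrightarrow> (\<forall>q\<in>Q. f differentiable (at q) \<and>
     (\<forall>v. (\<lambda>q. frechet_derivative f (at q) v) differentiable (at q)))"

lemma twice_differentiable_onD:
  assumes "twice_differentiable_on Q f" "q \<in> Q"
  shows "f differentiable (at q)" "(\<lambda>q. frechet_derivative f (at q) v) differentiable (at q)"
  using assms unfolding twice_differentiable_on_def by auto

lemma has_derivative_frechet_derivative:
  assumes "twice_differentiable_on Q f" "q \<in> Q"
  shows "(f has_derivative frechet_derivative f (at q)) (at q)"
    "((\<lambda>q. frechet_derivative f (at q) v) has_derivative
       frechet_derivative (\<lambda>q. frechet_derivative f (at q) v) (at q)) (at q)"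
  using twice_differentiable_onD[OF assms] unfolding frechet_derivative_works by blast+

text \<open>Since \<open>Q\<close> is open, the Frechet derivative coincides with the candidate
  \<open>f'\<close> near each point and not only at it, so a derivative of \<open>f'\<close> is a
  second derivative of \<open>f\<close>.\<close>

lemma twice_differentiable_on_if_has_derivative:
  assumes Q: "open Q"
    and f: "\<And>q. q \<in> Q \<Longrightarrow> (f has_derivative f' q) (at q)"
    and f': "\<And>q v. q \<in> Q \<Longrightarrow> ((\<lambda>q. f' q v) has_derivative f'' q v) (at q)"
  shows "twice_differentiable_on Q f"
    and "q \<in> Q \<Longrightarrow> frechet_derivative f (at q) = f' q"
    and "q \<in> Q \<Longrightarrow> frechet_derivative (\<lambda>q. frechet_derivative f (at q) v) (at q) = f'' q v"
proof -
  have eq: "frechet_derivative f (at q) = f' q" if "q \<in> Q" for q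
    using frechet_derivative_at[OF f[OF that]] by simp
  have D: "((\<lambda>q. frechet_derivative f (at q) v) has_derivative f'' q v) (at q)" if "q \<in> Q" for q v
    using f'[OF that] Q that by (rule has_derivative_transform_within_open) (simp add: eq)
  show "twice_differentiable_on Q f"
    unfolding twice_differentiable_on_def using f D by (meson differentiableI)
  show "frechet_derivative f (at q) = f' q" if "q \<in> Q"
    using that by (rule eq)
  show "frechet_derivative (\<lambda>q. frechet_derivative f (at q) v) (at q) = f'' q v" if "q \<in> Q"
    using frechet_derivative_at[OF D[OF that]] by simp
qed

lemma smooth_on_imp_twice_differentiable_on:
  assumes "smooth_on S f"
  shows "twice_differentiable_on S f"
  using spec[OF assms[unfolded smooth_on_def], of 2]
  unfolding twice_differentiable_on_def by (simp add: numeral_2_eq_2)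

text \<open>For \<open>f\<close> a partition function, the subtracted product in the second
  derivative becomes a product of two Gibbs averages; this is the origin of the covariance shape of
  the loss coefficients.\<close>

lemma
  assumes Q: "open Q" and f: "twice_differentiable_on Q f" and pos: "\<And>q. q \<in> Q \<Longrightarrow> f q > 0"
  shows twice_differentiable_on_ln: "twice_differentiable_on Q (\<lambda>q. ln (f q))"
    and frechet_derivative_ln:
      "q \<in> Q \<Longrightarrow> frechet_derivative (\<lambda>q. ln (f q)) (at q) v = frechet_derivative f
          (at q) v / f q"
    and frechet_derivative_ln_2:
      "q \<in> Q \<Longrightarrow> frechet_derivative (\<lambda>q. frechet_derivative (\<lambda>q. ln (f q))
          (at q) v) (at q) w =
         frechet_derivative (\<lambda>q. frechet_derivative f (at q) v) (at q) w / f q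
         - frechet_derivative f (at q) v / f q * (frechet_derivative f (at q) w / f q)"
proof -
  let ?f' = "\<lambda>q. frechet_derivative f (at q)"
  let ?f'' = "\<lambda>q v. frechet_derivative (\<lambda>q. frechet_derivative f (at q) v) (at q)"
  have 1: "((\<lambda>q. ln (f q)) has_derivative (\<lambda>v. ?f' q v / f q)) (at q)" if "q \<in> Q" for q
    using has_derivative_frechet_derivative(1)[OF f that] pos[OF that]
    by (auto intro!: derivative_eq_intros simp: divide_inverse)
  have 2: "((\<lambda>q. ?f' q v / f q) has_derivative
      (\<lambda>w. ?f'' q v w / f q - ?f' q v / f q * (?f' q w / f q))) (at q)" if "q \<in> Q" for q v
    using has_derivative_frechet_derivative[OF f that] pos[OF that]
    by (auto intro!: derivative_eq_intros simp: field_simps power2_eq_square)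
  note tw = twice_differentiable_on_if_has_derivative[OF Q 1 2]
  show "twice_differentiable_on Q (\<lambda>q. ln (f q))" by (rule tw)
  show "q \<in> Q \<Longrightarrow> frechet_derivative (\<lambda>q. ln (f q)) (at q) v = ?f' q v / f q"
    by (simp add: tw(2))
  show "q \<in> Q \<Longrightarrow> frechet_derivative (\<lambda>q. frechet_derivative (\<lambda>q. ln (f q))
      (at q) v) (at q) w =
         ?f'' q v w / f q - ?f' q v / f q * (?f' q w / f q)"
    by (simp only: tw(3))
qed

text \<open>Differentiation under the integral is used twice: on \<open>f\<close>, then on each of
  its directional derivatives, whose integrability is supplied by the first application.\<close>

lemma
  fixes f :: "'q::euclidean_space \<Rightarrow> 's \<Rightarrow> real"
  assumes Q: "open Q"
    and f: "\<And>s. s \<in> space \<mu> \<Longrightarrow> twice_differentiable_on Q (\<lambda>q. f q s)"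
    and int: "\<And>q. q \<in> Q \<Longrightarrow> integrable \<mu> (f q)"
    and dom: "dominated_derivs 2 \<mu> Q f"
  shows twice_differentiable_on_integral: "twice_differentiable_on Q (\<lambda>q. \<integral>s. f q s
      \<partial>\<mu>)"
    and integrable_dominated_derivs:
      "q \<in> Q \<Longrightarrow> integrable \<mu> (\<lambda>s. frechet_derivative (\<lambda>q. f q s) (at q) v)"
      "q \<in> Q \<Longrightarrow> integrable \<mu>
         (\<lambda>s. frechet_derivative (\<lambda>q. frechet_derivative (\<lambda>q. f q s) (at q) v) (at q) w)"
    and frechet_derivative_integral: "q \<in> Q \<Longrightarrow>
      frechet_derivative (\<lambda>q. \<integral>s. f q s \<partial>\<mu>) (at q) v =
        (\<integral>s. frechet_derivative (\<lambda>q. f q s) (at q) v \<partial>\<mu>)"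
    and frechet_derivative_integral_2: "q \<in> Q \<Longrightarrow>
      frechet_derivative (\<lambda>q. frechet_derivative (\<lambda>q. \<integral>s. f q s \<partial>\<mu>) (at
          q) v) (at q) w =
        (\<integral>s. frechet_derivative (\<lambda>q. frechet_derivative (\<lambda>q. f q s) (at q) v) (at q)
            w \<partial>\<mu>)"
proof -
  have dom1: "locally_dominated \<mu> Q (\<lambda>q s. frechet_derivative (\<lambda>q'. f q' s) (at q) v)"
    and dom2: "locally_dominated \<mu> Q (\<lambda>q s. frechet_derivative
      (\<lambda>q'. frechet_derivative (\<lambda>q'. f q' s) (at q') v) (at q) w)" for v w
    using dom by (auto simp: numeral_2_eq_2)
  note f1 = twice_differentiable_onD(1)[OF f] and f2 = twice_differentiable_onD(2)[OF f]
  have int1: "integrable \<mu> (\<lambda>s. frechet_derivative (\<lambda>q. f q s) (at q) v)" if "q \<in> Q" for q v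
    by (rule integrable_frechet_derivative[OF Q that f1 int dom1])
  have D1: "((\<lambda>q. \<integral>s. f q s \<partial>\<mu>) has_derivative
      (\<lambda>v. \<integral>s. frechet_derivative (\<lambda>q. f q s) (at q) v \<partial>\<mu>)) (at q)" if
          "q \<in> Q" for q
    by (rule has_derivative_integral_dominated[OF Q that f1 int dom1])
  have int2: "integrable \<mu>
      (\<lambda>s. frechet_derivative (\<lambda>q. frechet_derivative (\<lambda>q. f q s) (at q) v) (at q) w)"
    if "q \<in> Q" for q v w
    by (rule integrable_frechet_derivative[OF Q that f2 int1 dom2])
  have D2: "((\<lambda>q. \<integral>s. frechet_derivative (\<lambda>q. f q s) (at q) v \<partial>\<mu>)
      has_derivative
      (\<lambda>w. \<integral>s. frechet_derivative (\<lambda>q. frechet_derivative (\<lambda>q. f q s) (at q)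
          v) (at q) w \<partial>\<mu>))
      (at q)" if "q \<in> Q" for q v
    by (rule has_derivative_integral_dominated[OF Q that f2 int1 dom2])
  note tw = twice_differentiable_on_if_has_derivative[OF Q D1 D2]
  show "twice_differentiable_on Q (\<lambda>q. \<integral>s. f q s \<partial>\<mu>)" by (rule tw)
  show "q \<in> Q \<Longrightarrow> integrable \<mu> (\<lambda>s. frechet_derivative (\<lambda>q. f q s) (at q)
      v)" by (rule int1)
  show "q \<in> Q \<Longrightarrow> integrable \<mu>
      (\<lambda>s. frechet_derivative (\<lambda>q. frechet_derivative (\<lambda>q. f q s) (at q) v) (at q) w)"
          by (rule int2)
  show "q \<in> Q \<Longrightarrow> frechet_derivative (\<lambda>q. \<integral>s. f q s \<partial>\<mu>) (at q) v =
      (\<integral>s. frechet_derivative (\<lambda>q. f q s) (at q) v \<partial>\<mu>)"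
    by (simp only: tw(2))
  show "q \<in> Q \<Longrightarrow>
      frechet_derivative (\<lambda>q. frechet_derivative (\<lambda>q. \<integral>s. f q s \<partial>\<mu>) (at
          q) v) (at q) w =
        (\<integral>s. frechet_derivative (\<lambda>q. frechet_derivative (\<lambda>q. f q s) (at q) v) (at q)
            w \<partial>\<mu>)"
    by (simp only: tw(3))
qed

text \<open>A point \<open>q\<close> stands for \<open>(\<theta>, \<lambda>, \<gamma>)\<close>, and
    \<open>e\<^sup>-\<^sup>H = exp (ln m + \<lambda> ln d + \<gamma> ln c)\<close>.\<close>

lemma
  fixes a b c :: "'p::euclidean_space \<Rightarrow> real"
  defines "h \<equiv> \<lambda>q::'p \<times> real \<times> real. exp (a (fst q) + fst (snd q) * b (fst q) +
      snd (snd q) * c (fst q))"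
  defines "s \<equiv> \<lambda>q::'p \<times> real \<times> real. \<lambda>v. frechet_derivative a (at (fst q))
      (fst v)
      + (fst (snd v) * b (fst q) + fst (snd q) * frechet_derivative b (at (fst q)) (fst v))
      + (snd (snd v) * c (fst q) + snd (snd q) * frechet_derivative c (at (fst q)) (fst v))"
  assumes U: "open U" and W: "open W"
    and abc: "twice_differentiable_on U a" "twice_differentiable_on U b" "twice_differentiable_on U c"
  shows twice_differentiable_on_exp_tilted: "twice_differentiable_on (U \<times> W) h"
    and frechet_derivative_exp_tilted:
      "q \<in> U \<times> W \<Longrightarrow> frechet_derivative h (at q) v = h q * s q v"
    and frechet_derivative_exp_tilted_2:
      "q \<in> U \<times> W \<Longrightarrow>
        frechet_derivative (\<lambda>q. frechet_derivative h (at q) (0, 0, 1)) (at q) v =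
          h q * s q v * c (fst q) + h q * frechet_derivative c (at (fst q)) (fst v)"
proof -
  have D: "((\<lambda>q::'p \<times> real \<times> real. f (fst q)) has_derivative
      (\<lambda>v. frechet_derivative f (at (fst q)) (fst v))) (at q)"
    "((\<lambda>q::'p \<times> real \<times> real. frechet_derivative f (at (fst q)) u) has_derivative
      (\<lambda>v. frechet_derivative (\<lambda>p. frechet_derivative f (at p) u) (at (fst q)) (fst v))) (at q)"
    if "twice_differentiable_on U f" "q \<in> U \<times> W" for f q u
    using that(2)
    by (auto intro!: has_derivative_compose[OF has_derivative_fst[OF has_derivative_ident],
          where g = f] has_derivative_compose[OF has_derivative_fst[OF has_derivative_ident],
          where g = "\<lambda>p. frechet_derivative f (at p) u"] has_derivative_frechet_derivative[OF that(1)])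
  have 1: "(h has_derivative (\<lambda>v. h q * s q v)) (at q)" if "q \<in> U \<times> W" for q
    unfolding h_def s_def
    by (rule derivative_eq_intros D[OF _ that] abc refl)+ (auto simp: algebra_simps)
  \<comment> \<open>Product rule with Dh = h s. This general formula serves to establish twice
    differentiability; for the direction (0, 0, 1) a shorter expression is derived separately
    below.\<close>
  have 2: "((\<lambda>q. h q * s q v) has_derivative (\<lambda>w. h q * s q w * s q v + h q * (
       frechet_derivative (\<lambda>p. frechet_derivative a (at p) (fst v)) (at (fst q)) (fst w)
      + (fst (snd v) * frechet_derivative b (at (fst q)) (fst w)
        + (fst (snd w) * frechet_derivative b (at (fst q)) (fst v)
        + fst (snd q) * frechet_derivative (\<lambda>p. frechet_derivative b (at p) (fst v)) (at (fst q)) (fst w)))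
      + (snd (snd v) * frechet_derivative c (at (fst q)) (fst w)
        + (snd (snd w) * frechet_derivative c (at (fst q)) (fst v)
        + snd (snd q) * frechet_derivative (\<lambda>p. frechet_derivative c (at p) (fst v)) (at (fst q)) (fst
            w)))))) (at q)"
    if "q \<in> U \<times> W" for q v
    by (rule has_derivative_eq_rhs[OF has_derivative_mult[OF 1[OF that]]],
        unfold s_def, (rule derivative_eq_intros D[OF _ that] abc refl)+) (auto simp: algebra_simps)
  note tw = twice_differentiable_on_if_has_derivative[OF open_Times[OF U W] 1 2]
  show "twice_differentiable_on (U \<times> W) h" by (rule tw)
  show "q \<in> U \<times> W \<Longrightarrow> frechet_derivative h (at q) v = h q * s q v" by (simp only: tw(2))
  show "frechet_derivative (\<lambda>q. frechet_derivative h (at q) (0, 0, 1)) (at q) v =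
      h q * s q v * c (fst q) + h q * frechet_derivative c (at (fst q)) (fst v)" if q: "q \<in> U \<times> W"
  proof -
    have z: "frechet_derivative f (at p) 0 = 0" if "twice_differentiable_on U f" "p \<in> U" for f p
      using linear_frechet_derivative[OF twice_differentiable_onD(1)[OF that]] by (rule linear_0)
    \<comment> \<open>In the direction (0, 0, 1) the logarithmic derivative \<open>s\<close> reduces
      to \<open>c\<close>, because the derivatives of \<open>a\<close>, \<open>b\<close>,
      \<open>c\<close> vanish at the zero vector. Hence it suffices to differentiate the product of
      \<open>h\<close> and \<open>c\<close>.\<close>
    have 3: "((\<lambda>q. h q * c (fst q)) has_derivative
        (\<lambda>v. h q * s q v * c (fst q) + h q * frechet_derivative c (at (fst q)) (fst v))) (at q)"
      by (rule has_derivative_eq_rhs[OF has_derivative_mult[OF 1[OF q] D(1)[OF abc(3) q]]])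
        (auto simp: algebra_simps)
    have "((\<lambda>q. frechet_derivative h (at q) (0, 0, 1)) has_derivative
        (\<lambda>v. h q * s q v * c (fst q) + h q * frechet_derivative c (at (fst q)) (fst v))) (at q)"
    proof (rule has_derivative_transform_within_open[OF 3 open_Times[OF U W] q])
      fix p assume "p \<in> U \<times> W"
      then show "h p * c (fst p) = frechet_derivative h (at p) (0, 0, 1)"
        using z abc by (auto simp: tw(2) s_def)
    qed
    then show ?thesis by (simp only: frechet_derivative_at[symmetric])
  qed
qed

lemma inner_grad:
  assumes "f differentiable (at \<theta>)"
  shows "w \<bullet> grad f \<theta> = frechet_derivative f (at \<theta>) w"
proof -
  have lin: "linear (frechet_derivative f (at \<theta>))"
    using assms by (rule linear_frechet_derivative)
  have "frechet_derivative f (at \<theta>) w = frechet_derivative f (at \<theta>) (\<Sum>i\<in>UNIV. w $ i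
      *\<^sub>R axis i 1)"
    by (simp add: basis_expansion scalar_mult_eq_scaleR[symmetric])
  also have "\<dots> = (\<Sum>i\<in>UNIV. w $ i * frechet_derivative f (at \<theta>) (axis i 1))"
    using lin by (simp add: linear_sum linear_scale)
  finally show ?thesis
    by (simp add: inner_vec_def grad_def)
qed

section \<open>The partition function and its derivatives\<close>

lemma integrable_locally_dominated:
  assumes "locally_dominated \<mu> Q f" "q \<in> Q" "f q \<in> borel_measurable \<mu>"
  shows "integrable \<mu> (f q)"
proof -
  obtain V g where V: "q \<in> V" "integrable \<mu> g" and le: "AE s in \<mu>. \<forall>q\<in>V \<inter> Q.
      \<bar>f q s\<bar> \<le> g s"
    using bspec[OF assms(1)[unfolded locally_dominated_def] assms(2)] by blast
  show ?thesis
  proof (rule Bochner_Integration.integrable_bound[OF V(2) assms(3)])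
    show "AE s in \<mu>. norm (f q s) \<le> norm (g s)"
      using le
    proof eventually_elim
      case (elim s)
      then have "\<bar>f q s\<bar> \<le> g s" using V(1) assms(2) by blast
      then show ?case by simp
    qed
  qed
qed

text \<open>A summable real family has at most countably many nonzero terms, and here every term is
  nonzero.\<close>

lemma countable_if_positive_has_sum:
  fixes f :: "'a \<Rightarrow> real"
  assumes "(f has_sum a) UNIV" "\<And>y. f y > 0"
  shows "countable (UNIV :: 'a set)"
proof -
  have "countable {y \<in> UNIV. f y \<noteq> 0}"
    using assms(1) by (intro summable_countable_real) (auto simp: summable_on_def)
  moreover have "{y \<in> UNIV. f y \<noteq> 0} = UNIV"
    using assms(2) by (auto simp: less_imp_neq[symmetric])
  ultimately show ?thesis by simp
qed

lemma has_derivative_vec_lambda: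
  fixes f :: "'i::finite \<Rightarrow> 'a::real_normed_vector \<Rightarrow> real"
  assumes "\<And>i. (f i has_derivative f' i) (at x within S)"
  shows "((\<lambda>x. \<chi> i. f i x) has_derivative (\<lambda>v. \<chi> i. f' i v)) (at x within S)"
  unfolding has_derivative_componentwise_within[of "\<lambda>x. \<chi> i. f i x"]
  using assms by (auto simp: Basis_vec_def inner_axis)

lemma matrix_inv_mult_vector:
  fixes A :: "real^'n^'n"
  assumes "invertible A"
  shows "matrix_inv A *v (A *v x) = x"
proof -
  have "matrix_inv A ** A = mat 1"
    using someI_ex[OF assms[unfolded invertible_def]] unfolding matrix_inv_def by blast
  then show ?thesis by (simp add: matrix_vector_mul_assoc)
qed

text \<open>A parameter in \<open>params M\<close> provides a normalised prior and classifier, from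
  which positivity of Z and countability of the labels follow. For the equilibrium path, any point
  of the path is such a parameter.\<close>

locale regular_latent_model =
  fixes M :: "('x, 'y, 'z, 'n::finite) latent_model"
    and U :: "(real^'n) set" and W :: "(real \<times> real) set"
  assumes density: "density_model M U"
    and regular: "regular_model M U W"
    and params_nonempty: "params M \<noteq> {}"
begin

abbreviation boltzmann :: "'x \<Rightarrow> (real^'n) \<times> real \<times> real \<Rightarrow> 'z
    \<Rightarrow> real" where
  "boltzmann x q z \<equiv> exp (- hamiltonian M z x (fst q) (fst (snd q)) (snd (snd q)))"

abbreviation partition_fun :: "'x \<Rightarrow> (real^'n) \<times> real \<times> real \<Rightarrow> real" where
  "partition_fun x q \<equiv> norm_const M x (fst q) (fst (snd q)) (snd (snd q))"

text \<open>The function K of the overview, taken as a function of one joint variable so that a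
  single Frechet derivative contains the derivatives in \<theta>, \<lambda> and \<gamma>.\<close>

definition neg_J :: "(real^'n) \<times> real \<times> real \<Rightarrow> real" where
  "neg_J q = (\<integral>x. ln (partition_fun x q) \<partial>data M)"

lemma open_dom: "open U" "open W" "open (U \<times> W)"
  using density regular unfolding density_model_def regular_model_def by (auto intro: open_Times)

lemma params_subset: "params M \<subseteq> U"
  using density unfolding density_model_def by (elim conjE)

lemma smooth_densities:
  assumes "z \<in> space (latent M)"
  shows "\<forall>\<theta>\<in>U. prior M \<theta> z > 0" "smooth_on U (\<lambda>\<theta>. prior M \<theta> z)"
    "x \<in> space (data M) \<Longrightarrow> \<forall>\<theta>\<in>U. decoder M \<theta> x z > 0"
    "x \<in> space (data M) \<Longrightarrow> smooth_on U (\<lambda>\<theta>. decoder M \<theta> x z)"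
    "\<forall>\<theta>\<in>U. classifier M \<theta> y z > 0" "smooth_on U (\<lambda>\<theta>. classifier M
        \<theta> y z)"
  using density assms unfolding density_model_def by auto

lemma twice_differentiable_on_ln_density:
  assumes "z \<in> space (latent M)"
  shows "twice_differentiable_on U (\<lambda>\<theta>. ln (prior M \<theta> z))"
    "x \<in> space (data M) \<Longrightarrow> twice_differentiable_on U (\<lambda>\<theta>. ln (decoder M
        \<theta> x z))"
    "twice_differentiable_on U (\<lambda>\<theta>. ln (classifier M \<theta> y z))"
  using smooth_densities[OF assms] open_dom
  by (auto intro!: twice_differentiable_on_ln intro: smooth_on_imp_twice_differentiable_on)

lemma boltzmann_eq:
  "boltzmann x q z = exp (ln (prior M (fst q) z) + fst (snd q) * ln (decoder M (fst q) x z)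
     + snd (snd q) * ln (classifier M (fst q) (label M x) z))"
  by (simp add: hamiltonian_def)

context
  fixes x z assumes x: "x \<in> space (data M)" and z: "z \<in> space (latent M)"
begin

lemma twice_differentiable_on_boltzmann: "twice_differentiable_on (U \<times> W) (\<lambda>q. boltzmann x q z)"
  unfolding boltzmann_eq
  by (rule twice_differentiable_on_exp_tilted[OF open_dom(1,2) twice_differentiable_on_ln_density[OF z]])
    (rule x)

lemmas frechet_derivative_boltzmann =
  frechet_derivative_exp_tilted[OF open_dom(1,2) twice_differentiable_on_ln_density(1,2)[OF z]
    twice_differentiable_on_ln_density(3)[OF z, of "label M x"], OF x, folded boltzmann_eq]

lemmas frechet_derivative_boltzmann_2 =
  frechet_derivative_exp_tilted_2[OF open_dom(1,2) twice_differentiable_on_ln_density(1,2)[OF z]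
    twice_differentiable_on_ln_density(3)[OF z, of "label M x"], OF x, folded boltzmann_eq]

end

lemma integrable_boltzmann:
  assumes "x \<in> space (data M)" "q \<in> U \<times> W"
  shows "integrable (latent M) (boltzmann x q)"
  using regular assms unfolding regular_model_def by fastforce

lemma dominated_boltzmann:
  assumes "x \<in> space (data M)"
  shows "dominated_derivs 2 (latent M) (U \<times> W) (boltzmann x)"
proof -
  have "dominated_derivs 2 (latent M) (U \<times> W) (\<lambda>(\<theta>, l, g) z. exp (- hamiltonian M z x
      \<theta> l g))"
    using regular assms unfolding regular_model_def by blast
  then show ?thesis by (simp add: case_prod_beta')
qed

lemma dominated_ln_partition_fun:
  "dominated_derivs 2 (data M) (U \<times> W) (\<lambda>q x. ln (partition_fun x q))"
proof -
  have "dominated_derivs 2 (data M) (U \<times> W) (\<lambda>(\<theta>, l, g) x. ln (norm_const M x \<theta> l g))"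
    using regular unfolding regular_model_def by blast
  then show ?thesis by (simp add: case_prod_beta')
qed

text \<open>A null latent measure would make the integral of a prior 0, while it is 1 for every
  admissible parameter.\<close>

lemma not_AE_latent_False: "\<not> (AE z in latent M. False)"
proof
  assume AE: "AE z in latent M. False"
  obtain \<theta> where "\<theta> \<in> params M" using params_nonempty by blast
  then have "(\<integral>\<^sup>+z. ennreal (prior M \<theta> z) \<partial>latent M) = 1"
    using density unfolding density_model_def by blast
  moreover have "(\<integral>\<^sup>+z. ennreal (prior M \<theta> z) \<partial>latent M) =
      (\<integral>\<^sup>+z. 0 \<partial>latent M)"
    using AE by (intro nn_integral_cong_AE) auto
  ultimately show False by simp
qed

text \<open>A nonnegative integrable function with integral 0 vanishes almost everywhere; an
  exponential vanishes nowhere, so this would make the latent measure null.\<close>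

lemma partition_fun_pos:
  assumes "x \<in> space (data M)" "q \<in> U \<times> W"
  shows "partition_fun x q > 0"
proof -
  have "partition_fun x q \<noteq> 0"
    using integral_nonneg_eq_0_iff_AE[OF integrable_boltzmann[OF assms]] not_AE_latent_False
    by (simp add: norm_const_def)
  moreover have "partition_fun x q \<ge> 0"
    by (simp add: norm_const_def)
  ultimately show ?thesis by simp
qed

text \<open>Positivity makes every label an atom; countability is what gives joint measurability of
  \<open>(x, z) \<mapsto> c (y\<^sub>x | z)\<close>, since the classifier is only measurable in
      \<open>z\<close> for each label.\<close>

lemma countable_labels: "countable (UNIV :: 'y set)"
proof -
  obtain z where z: "z \<in> space (latent M)"
    using not_AE_latent_False by fastforce
  obtain \<theta> where \<theta>: "\<theta> \<in> params M" using params_nonempty by blast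
  show ?thesis
  proof (rule countable_if_positive_has_sum)
    show "((\<lambda>y. classifier M \<theta> y z) has_sum 1) UNIV"
      using density \<theta> z unfolding density_model_def by blast
    show "classifier M \<theta> y z > 0" for y
      using smooth_densities(5)[OF z] \<theta> params_subset by blast
  qed
qed

lemma borel_measurable_partition_fun:
  assumes "q \<in> U \<times> W"
  shows "(\<lambda>x. partition_fun x q) \<in> borel_measurable (data M)"
proof -
  have q: "fst q \<in> U" using assms by auto
  \<comment> \<open>Joint measurability of the decoder is given with respect to the reference
    measure on \<open>x\<close>; it carries over because the data distribution has the same
    measurable sets.\<close>
  have "sets (data M \<Otimes>\<^sub>M latent M) = sets (data_ref M \<Otimes>\<^sub>M latent M)"
    using density unfolding density_model_def by (intro sets_pair_measure_cong) auto
  then have [measurable]: "(\<lambda>p. decoder M (fst q) (fst p) (snd p)) \<in> borel_measurable (data M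
      \<Otimes>\<^sub>M latent M)"
    using density q unfolding density_model_def
    by (subst measurable_cong_sets[OF _ refl]) (auto simp: case_prod_beta')
  have [measurable]: "prior M (fst q) \<in> borel_measurable (latent M)"
    "classifier M (fst q) y \<in> borel_measurable (latent M)"
    "label M \<in> measurable (data M) (count_space UNIV)" for y
    using density q unfolding density_model_def by auto
  have [measurable]: "(\<lambda>p. classifier M (fst q) (label M (fst p)) (snd p))
      \<in> borel_measurable (data M \<Otimes>\<^sub>M latent M)"
    by (rule measurable_compose_countable'[where I = UNIV
          and f = "\<lambda>y p. classifier M (fst q) y (snd p)" and g = "\<lambda>p. label M (fst p)"])
      (use countable_labels in measurable)
  interpret sigma_finite_measure "latent M"
    using density unfolding density_model_def by blast
  have "(\<lambda>x. \<integral>z. boltzmann x q z \<partial>latent M) \<in> borel_measurable (data M)"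
    by (rule borel_measurable_lebesgue_integral)
      (simp add: hamiltonian_def case_prod_beta')
  then show ?thesis by (simp add: norm_const_def)
qed

section \<open>Derivatives of the partition function and of its expected logarithm\<close>

lemma
  assumes x: "x \<in> space (data M)"
  shows twice_differentiable_on_partition_fun: "twice_differentiable_on (U \<times> W) (partition_fun x)"
    and frechet_derivative_partition_fun: "q \<in> U \<times> W \<Longrightarrow>
      frechet_derivative (partition_fun x) (at q) v =
        (\<integral>z. frechet_derivative (\<lambda>q. boltzmann x q z) (at q) v \<partial>latent M)"
    and frechet_derivative_partition_fun_2: "q \<in> U \<times> W \<Longrightarrow>
      frechet_derivative (\<lambda>q. frechet_derivative (partition_fun x) (at q) v) (at q) w =
        (\<integral>z. frechet_derivative (\<lambda>q. frechet_derivative (\<lambda>q. boltzmann x q z) (at q)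
            v) (at q) w \<partial>latent M)"
  unfolding norm_const_def
  using twice_differentiable_on_integral[OF open_dom(3) twice_differentiable_on_boltzmann[OF x]
      integrable_boltzmann[OF x] dominated_boltzmann[OF x]]
    frechet_derivative_integral[OF open_dom(3) twice_differentiable_on_boltzmann[OF x]
      integrable_boltzmann[OF x] dominated_boltzmann[OF x]]
    frechet_derivative_integral_2[OF open_dom(3) twice_differentiable_on_boltzmann[OF x]
      integrable_boltzmann[OF x] dominated_boltzmann[OF x]]
  by blast+

lemma integrable_boltzmann_derivs:
  assumes "x \<in> space (data M)" "q \<in> U \<times> W"
  shows "integrable (latent M) (\<lambda>z. frechet_derivative (\<lambda>q. boltzmann x q z) (at q) v)"
    "integrable (latent M)
      (\<lambda>z. frechet_derivative (\<lambda>q. frechet_derivative (\<lambda>q. boltzmann x q z) (at q) v)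
          (at q) w)"
  using integrable_dominated_derivs[OF open_dom(3) twice_differentiable_on_boltzmann
    integrable_boltzmann dominated_boltzmann] assms by blast+

text \<open>The order-zero part of the domination bounds log Z by an integrable function of
  \<open>x\<close>; together with measurability of Z in \<open>x\<close> this gives
  integrability.\<close>

lemma integrable_ln_partition_fun:
  assumes "q \<in> U \<times> W"
  shows "integrable (data M) (\<lambda>x. ln (partition_fun x q))"
proof (rule integrable_locally_dominated[OF _ assms])
  show "locally_dominated (data M) (U \<times> W) (\<lambda>q x. ln (partition_fun x q))"
    using dominated_ln_partition_fun by (simp add: numeral_2_eq_2)
  show "(\<lambda>x. ln (partition_fun x q)) \<in> borel_measurable (data M)"
    by (rule borel_measurable_ln[OF borel_measurable_partition_fun[OF assms]])
qed

lemma twice_differentiable_on_ln_partition_fun: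
  "x \<in> space (data M) \<Longrightarrow> twice_differentiable_on (U \<times> W) (\<lambda>q. ln
      (partition_fun x q))"
  by (rule twice_differentiable_on_ln[OF open_dom(3) twice_differentiable_on_partition_fun partition_fun_pos])

lemma twice_differentiable_on_neg_J: "twice_differentiable_on (U \<times> W) neg_J"
  unfolding neg_J_def[abs_def]
  using twice_differentiable_on_integral[OF open_dom(3) twice_differentiable_on_ln_partition_fun
    integrable_ln_partition_fun dominated_ln_partition_fun] by blast

lemma frechet_derivative_neg_J:
  assumes q: "q \<in> U \<times> W"
  shows "frechet_derivative neg_J (at q) v =
    (\<integral>x. (\<integral>z. frechet_derivative (\<lambda>q. boltzmann x q z) (at q) v \<partial>latent M)
        / partition_fun x q \<partial>data M)"
proof -
  have "frechet_derivative neg_J (at q) v =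
      (\<integral>x. frechet_derivative (\<lambda>q. ln (partition_fun x q)) (at q) v \<partial>data M)"
    unfolding neg_J_def[abs_def]
    using frechet_derivative_integral[OF open_dom(3) twice_differentiable_on_ln_partition_fun
      integrable_ln_partition_fun dominated_ln_partition_fun] q by blast
  also have "\<dots> = (\<integral>x. (\<integral>z. frechet_derivative (\<lambda>q. boltzmann x q z) (at q) v
      \<partial>latent M) / partition_fun x q \<partial>data M)"
  proof (rule Bochner_Integration.integral_cong[OF refl])
    fix x assume x: "x \<in> space (data M)"
    show "frechet_derivative (\<lambda>q. ln (partition_fun x q)) (at q) v =
        (\<integral>z. frechet_derivative (\<lambda>q. boltzmann x q z) (at q) v \<partial>latent M) /
            partition_fun x q"
      using frechet_derivative_ln[OF open_dom(3) twice_differentiable_on_partition_fun[OF x]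
          partition_fun_pos[OF x] q] frechet_derivative_partition_fun[OF x q] by simp
  qed
  finally show ?thesis .
qed

lemma frechet_derivative_neg_J_2:
  assumes q: "q \<in> U \<times> W"
  shows "frechet_derivative (\<lambda>q. frechet_derivative neg_J (at q) v) (at q) w =
    (\<integral>x. (\<integral>z. frechet_derivative (\<lambda>q. frechet_derivative (\<lambda>q. boltzmann x q
        z) (at q) v) (at q) w \<partial>latent M)
          / partition_fun x q
        - (\<integral>z. frechet_derivative (\<lambda>q. boltzmann x q z) (at q) v \<partial>latent M) /
            partition_fun x q
          * ((\<integral>z. frechet_derivative (\<lambda>q. boltzmann x q z) (at q) w \<partial>latent M) /
              partition_fun x q) \<partial>data M)"
    (is "_ = (\<integral>x. ?R x \<partial>data M)")
proof -
  have "frechet_derivative (\<lambda>q. frechet_derivative neg_J (at q) v) (at q) w =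
      (\<integral>x. frechet_derivative (\<lambda>q. frechet_derivative (\<lambda>q. ln (partition_fun x q))
          (at q) v) (at q) w \<partial>data M)"
    unfolding neg_J_def[abs_def]
    using frechet_derivative_integral_2[OF open_dom(3) twice_differentiable_on_ln_partition_fun
      integrable_ln_partition_fun dominated_ln_partition_fun] q by blast
  also have "\<dots> = (\<integral>x. ?R x \<partial>data M)"
  proof (rule Bochner_Integration.integral_cong[OF refl])
    fix x assume x: "x \<in> space (data M)"
    show "frechet_derivative (\<lambda>q. frechet_derivative (\<lambda>q. ln (partition_fun x q)) (at q) v) (at
        q) w = ?R x"
      using frechet_derivative_ln_2[OF open_dom(3) twice_differentiable_on_partition_fun[OF x]
          partition_fun_pos[OF x] q] frechet_derivative_partition_fun[OF x q]
        frechet_derivative_partition_fun_2[OF x q] by simp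
  qed
  finally show ?thesis .
qed

section \<open>The classification loss and its coefficients as derivatives of
  \<open>neg_J\<close>\<close>

lemma frechet_derivative_zero_ln_density:
  assumes "z \<in> space (latent M)" "\<theta> \<in> U"
  shows "frechet_derivative (\<lambda>\<theta>. ln (prior M \<theta> z)) (at \<theta>) 0 = 0"
    "x \<in> space (data M) \<Longrightarrow> frechet_derivative (\<lambda>\<theta>. ln (decoder M \<theta> x
        z)) (at \<theta>) 0 = 0"
    "frechet_derivative (\<lambda>\<theta>. ln (classifier M \<theta> y z)) (at \<theta>) 0 = 0"
  using twice_differentiable_onD(1)[OF twice_differentiable_on_ln_density(1)[OF assms(1)] assms(2)]
    twice_differentiable_onD(1)[OF twice_differentiable_on_ln_density(2)[OF assms(1)] assms(2)]
    twice_differentiable_onD(1)[OF twice_differentiable_on_ln_density(3)[OF assms(1)] assms(2)]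
  by (auto intro: linear_0[OF linear_frechet_derivative])

lemma frechet_derivative_boltzmann_gamma:
  assumes "x \<in> space (data M)" "z \<in> space (latent M)" "(\<theta>, l, g) \<in> U \<times> W"
  shows "frechet_derivative (\<lambda>q. boltzmann x q z) (at (\<theta>, l, g)) (0, 0, 1) =
    boltzmann x (\<theta>, l, g) z * log_class M z x \<theta>"
  using frechet_derivative_boltzmann[OF assms] frechet_derivative_zero_ln_density[OF assms(2)] assms
  by (simp add: log_class_def)

lemma class_loss_eq:
  assumes q: "(\<theta>, l, g) \<in> U \<times> W"
  shows "class_loss M \<theta> l g = - frechet_derivative neg_J (at (\<theta>, l, g)) (0, 0, 1)"
proof -
  have "class_loss M \<theta> l g =
      (\<integral>x. - ((\<integral>z. frechet_derivative (\<lambda>q. boltzmann x q z) (at (\<theta>, l, g))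
          (0, 0, 1) \<partial>latent M)
        / partition_fun x (\<theta>, l, g)) \<partial>data M)"
    unfolding class_loss_def
  proof (rule Bochner_Integration.integral_cong[OF refl])
    fix x assume x: "x \<in> space (data M)"
    have "(\<integral>z. encoder M \<theta> l g z x * ln (classifier M \<theta> (label M x) z) \<partial>latent M) =
        (\<integral>z. frechet_derivative (\<lambda>q. boltzmann x q z) (at (\<theta>, l, g)) (0, 0, 1)
          / partition_fun x (\<theta>, l, g) \<partial>latent M)"
      by (rule Bochner_Integration.integral_cong[OF refl])
        (simp add: frechet_derivative_boltzmann_gamma[OF x _ q] encoder_def log_class_def)
    then show "- (\<integral>z. encoder M \<theta> l g z x * ln (classifier M \<theta> (label M x) z)
        \<partial>latent M) =
        - ((\<integral>z. frechet_derivative (\<lambda>q. boltzmann x q z) (at (\<theta>, l, g)) (0, 0, 1)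
            \<partial>latent M)
          / partition_fun x (\<theta>, l, g))"
      by simp
  qed
  then show ?thesis
    by (simp add: frechet_derivative_neg_J[OF q])
qed

text \<open>One computation covers both coefficients: the first argument is the derivative of H in
  the multiplier direction (a, b), so (1, 0) yields the \<lambda> coefficient and (0, 1) the
  \<gamma> coefficient. The right-hand side is the derivative of C in the direction (w, a,
  b).\<close>

lemma loss_coeff_eq:
  assumes q: "(\<theta>, l, g) \<in> U \<times> W"
  shows "loss_coeff M \<theta> l g (\<lambda>z x. - (a * ln (decoder M \<theta> x z) + b * log_class M z x
      \<theta>)) w =
    - frechet_derivative (\<lambda>q. frechet_derivative neg_J (at q) (0, 0, 1)) (at (\<theta>, l, g)) (w, a, b)"
proof -
  have \<theta>: "\<theta> \<in> U" and lg: "(l, g) \<in> W" using q by auto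
  show ?thesis
    unfolding loss_coeff_def Let_def frechet_derivative_neg_J_2[OF q] neg_equal_iff_equal
  proof (rule Bochner_Integration.integral_cong[OF refl])
    fix x assume x: "x \<in> space (data M)"
    \<comment> \<open>The signs absorb the minus in e^(-H): \<open>r\<close> and \<open>p\<close>
      are the derivatives of -H in the directions (0, a, b) and (w, 0, 0). The first derivative of
      the weight \<open>h\<close> is then (p + r) h, and its derivative after the one in \<gamma> is
      (c p + r c + dc) h.\<close>
    define h where "h z = exp (- hamiltonian M z x \<theta> l g)" for z
    define c where "c z = log_class M z x \<theta>" for z
    define r where "r z = a * ln (decoder M \<theta> x z) + b * c z" for z
    define dc where "dc z = w \<bullet> grad (log_class M z x) \<theta>" for z
    define p where "p z = - (w \<bullet> grad (\<lambda>\<theta>'. hamiltonian M z x \<theta>' l g) \<theta>)" for z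
    let ?I = "\<lambda>f. \<integral>z. f z \<partial>latent M"
    let ?h' = "\<lambda>v z. frechet_derivative (\<lambda>q. boltzmann x q z) (at (\<theta>, l, g)) v"
    let ?h'' = "\<lambda>v z. frechet_derivative (\<lambda>q. frechet_derivative (\<lambda>q. boltzmann x q z)
        (at q) (0, 0, 1))
      (at (\<theta>, l, g)) v"
    have dc_eq: "dc z = frechet_derivative (\<lambda>\<theta>. ln (classifier M \<theta> (label M x) z)) (at
        \<theta>) w"
      and p_eq: "p z = frechet_derivative (\<lambda>\<theta>. ln (prior M \<theta> z)) (at \<theta>) w
         + l * frechet_derivative (\<lambda>\<theta>. ln (decoder M \<theta> x z)) (at \<theta>) w
         + g * frechet_derivative (\<lambda>\<theta>. ln (classifier M \<theta> (label M x) z)) (at \<theta>) w"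
      if z: "z \<in> space (latent M)" for z
    proof -
      note D = has_derivative_frechet_derivative(1)[OF twice_differentiable_on_ln_density(1)[OF z] \<theta>]
        has_derivative_frechet_derivative(1)[OF twice_differentiable_on_ln_density(2)[OF z x] \<theta>]
        has_derivative_frechet_derivative(1)[OF twice_differentiable_on_ln_density(3)[OF z] \<theta>, of "label M x"]
      show "dc z = frechet_derivative (\<lambda>\<theta>. ln (classifier M \<theta> (label M x) z)) (at \<theta>) w"
        unfolding dc_def log_class_def[abs_def] using D(3) by (intro inner_grad differentiableI)
      have "((\<lambda>\<theta>. hamiltonian M z x \<theta> l g) has_derivative
          (\<lambda>w. - frechet_derivative (\<lambda>\<theta>. ln (prior M \<theta> z)) (at \<theta>) w
            - l * frechet_derivative (\<lambda>\<theta>. ln (decoder M \<theta> x z)) (at \<theta>) w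
            - g * frechet_derivative (\<lambda>\<theta>. ln (classifier M \<theta> (label M x) z)) (at
                \<theta>) w)) (at \<theta>)"
        unfolding hamiltonian_def
        by (intro has_derivative_diff has_derivative_minus has_derivative_mult_right D)
      then show "p z = frechet_derivative (\<lambda>\<theta>. ln (prior M \<theta> z)) (at \<theta>) w
         + l * frechet_derivative (\<lambda>\<theta>. ln (decoder M \<theta> x z)) (at \<theta>) w
         + g * frechet_derivative (\<lambda>\<theta>. ln (classifier M \<theta> (label M x) z)) (at \<theta>) w"
        unfolding p_def by (subst inner_grad) (auto intro: differentiableI simp: frechet_derivative_at[symmetric])
    qed
    have h'_eq: "?h' (w, a, b) z = p z * h z + r z * h z"
      "?h' (w, 0, 0) z = p z * h z" "?h' (0, a, b) z = r z * h z" "?h' (0, 0, 1) z = c z * h z"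
      and h''_eq: "?h'' (w, a, b) z = c z * p z * h z + r z * c z * h z + dc z * h z"
      "?h'' (w, 0, 0) z = c z * p z * h z + dc z * h z" "?h'' (0, a, b) z = r z * c z * h z"
      if z: "z \<in> space (latent M)" for z
      using frechet_derivative_boltzmann[OF x z q] frechet_derivative_boltzmann_2[OF x z q]
        frechet_derivative_zero_ln_density[OF z \<theta>] x
      by (simp_all add: p_eq[OF z] dc_eq[OF z] h_def c_def r_def log_class_def algebra_simps)
    \<comment> \<open>The general direction yields integrability of sums only; the special
      directions (0, a, b) and (w, 0, 0) isolate the individual terms.\<close>
    have i_r: "integrable (latent M) (\<lambda>z. r z * h z)"
      using integrable_boltzmann_derivs(1)[OF x q, of "(0, a, b)"]
      by (rule Bochner_Integration.integrable_cong[OF refl, THEN iffD1, rotated]) (rule h'_eq)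
    have i_p: "integrable (latent M) (\<lambda>z. p z * h z)"
      using integrable_boltzmann_derivs(1)[OF x q, of "(w, 0, 0)"]
      by (rule Bochner_Integration.integrable_cong[OF refl, THEN iffD1, rotated]) (rule h'_eq)
    have i_rc: "integrable (latent M) (\<lambda>z. r z * c z * h z)"
      using integrable_boltzmann_derivs(2)[OF x q, of "(0, 0, 1)" "(0, a, b)"]
      by (rule Bochner_Integration.integrable_cong[OF refl, THEN iffD1, rotated]) (rule h''_eq)
    \<comment> \<open>Even the direction (w, 0, 0) leaves \<open>c p h\<close> and
      \<open>dc h\<close> together. Integrability of e^(-H) grad \<ell>, paired with
      \<open>w\<close>, handles \<open>dc h\<close>, and subtraction then handles
      \<open>c p h\<close>.\<close>
    have i_cp': "integrable (latent M) (\<lambda>z. c z * p z * h z + dc z * h z)"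
      using integrable_boltzmann_derivs(2)[OF x q, of "(0, 0, 1)" "(w, 0, 0)"]
      by (rule Bochner_Integration.integrable_cong[OF refl, THEN iffD1, rotated]) (rule h''_eq)
    have "integrable (latent M) (\<lambda>z. exp (- hamiltonian M z x \<theta> l g) *\<^sub>R grad
        (\<lambda>\<theta>'. log_class M z x \<theta>') \<theta>)"
      using regular x \<theta> lg unfolding regular_model_def by fast
    then have "integrable (latent M) (\<lambda>z. w \<bullet> (exp (- hamiltonian M z x \<theta> l g) *\<^sub>R
        grad (\<lambda>\<theta>'. log_class M z x \<theta>') \<theta>))"
      by (rule integrable_inner_right)
    then have i_dc: "integrable (latent M) (\<lambda>z. dc z * h z)"
      by (simp add: dc_def h_def mult.commute)
    have i_cp: "integrable (latent M) (\<lambda>z. c z * p z * h z)"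
      using Bochner_Integration.integrable_diff[OF i_cp' i_dc] by simp
    have "?I (?h' (w, a, b)) = (\<integral>z. p z * h z + r z * h z \<partial>latent M)"
      by (rule Bochner_Integration.integral_cong[OF refl]) (rule h'_eq)
    then have I1: "?I (?h' (w, a, b)) = (\<integral>z. p z * h z \<partial>latent M) + (\<integral>z. r z * h z
        \<partial>latent M)"
      using i_p i_r by simp
    have I2: "?I (?h' (0, 0, 1)) = (\<integral>z. c z * h z \<partial>latent M)"
      by (rule Bochner_Integration.integral_cong[OF refl]) (rule h'_eq)
    have "?I (?h'' (w, a, b)) = (\<integral>z. c z * p z * h z + r z * c z * h z + dc z * h z \<partial>latent M)"
      by (rule Bochner_Integration.integral_cong[OF refl]) (rule h''_eq)
    then have I3: "?I (?h'' (w, a, b)) = (\<integral>z. c z * p z * h z \<partial>latent M)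
        + (\<integral>z. r z * c z * h z \<partial>latent M) + (\<integral>z. dc z * h z \<partial>latent M)"
      using i_cp i_rc i_dc by simp
    have Z: "partition_fun x (\<theta>, l, g) = ?I h"
      by (simp add: norm_const_def h_def)
    have gibbs: "gibbs M x \<theta> l g f = (\<integral>z. f z * h z \<partial>latent M) / ?I h" for f
      by (simp add: gibbs_def h_def)
    show "gibbs M x \<theta> l g (\<lambda>z. - (a * ln (decoder M \<theta> x z) + b * log_class M z x \<theta>))
          * gibbs M x \<theta> l g (\<lambda>z. log_class M z x \<theta>)
        - gibbs M x \<theta> l g (\<lambda>z. - (a * ln (decoder M \<theta> x z) + b * log_class M z x
            \<theta>) * log_class M z x \<theta>)
        + gibbs M x \<theta> l g (\<lambda>z. w \<bullet> grad (\<lambda>\<theta>'. hamiltonian M z x \<theta>'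
            l g) \<theta>)
          * gibbs M x \<theta> l g (\<lambda>z. log_class M z x \<theta>)
        - gibbs M x \<theta> l g (\<lambda>z. log_class M z x \<theta> * (w \<bullet> grad (\<lambda>\<theta>'.
            hamiltonian M z x \<theta>' l g) \<theta>))
        + gibbs M x \<theta> l g (\<lambda>z. w \<bullet> grad (\<lambda>\<theta>'. log_class M z x \<theta>')
            \<theta>) =
      ?I (?h'' (w, a, b)) / partition_fun x (\<theta>, l, g)
        - ?I (?h' (0, 0, 1)) / partition_fun x (\<theta>, l, g) * (?I (?h' (w, a, b)) / partition_fun x
            (\<theta>, l, g))"
      (is "gibbs M x \<theta> l g ?r * _ - gibbs M x \<theta> l g ?rc + gibbs M x \<theta> l g ?p * _ - gibbs M
          x \<theta> l g ?cp + _ = _")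
    proof -
      have "?r = (\<lambda>z. - r z)" "?rc = (\<lambda>z. - (r z * c z))" "?p = (\<lambda>z. - p z)" "?cp =
          (\<lambda>z. - (c z * p z))"
        by (simp_all add: r_def c_def p_def fun_eq_iff algebra_simps)
      then show ?thesis
        unfolding I1 I2 I3 Z c_def[symmetric] dc_def[symmetric]
        by (simp add: gibbs add_divide_distrib algebra_simps)
    qed
  qed
qed

section \<open>The equilibrium path\<close>

abbreviation gradient :: "(real^'n) \<times> real \<times> real \<Rightarrow> real^'n" where
  "gradient q \<equiv> grad_J M (fst q) (fst (snd q)) (snd (snd q))"

abbreviation gradient_deriv :: "(real^'n) \<times> real \<times> real \<Rightarrow> (real^'n) \<times> real
    \<times> real \<Rightarrow> real^'n" where
  "gradient_deriv q v \<equiv>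
     \<chi> i. - frechet_derivative (\<lambda>q. frechet_derivative neg_J (at q) (axis i 1, 0, 0)) (at q) v"

lemma J_fun_eq: "J_fun M \<theta> l g = - neg_J (\<theta>, l, g)"
  by (simp add: J_fun_def neg_J_def)

lemma grad_J_eq:
  assumes "q \<in> U \<times> W"
  shows "gradient q = (\<chi> i. - frechet_derivative neg_J (at q) (axis i 1, 0, 0))"
proof -
  obtain \<theta> l g where q: "q = (\<theta>, l, g)" by (cases q) auto
  have "((\<lambda>\<theta>'. (\<theta>', l, g)) has_derivative (\<lambda>w. (w, 0, 0))) (at \<theta>)"
    by (intro has_derivative_Pair has_derivative_ident has_derivative_const)
  from has_derivative_minus[OF has_derivative_compose[OF this
      has_derivative_frechet_derivative(1)[OF twice_differentiable_on_neg_J assms[unfolded q]]]]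
  have "((\<lambda>\<theta>'. J_fun M \<theta>' l g) has_derivative
      (\<lambda>w. - frechet_derivative neg_J (at (\<theta>, l, g)) (w, 0, 0))) (at \<theta>)"
    by (simp add: J_fun_eq)
  then show ?thesis
    by (simp add: q grad_J_def grad_def frechet_derivative_at[symmetric])
qed

text \<open>The formula for the gradient of J through \<open>neg_J\<close> holds on an open set, so
  it may be differentiated once more, component by component.\<close>

lemma has_derivative_gradient:
  assumes "q \<in> U \<times> W"
  shows "(gradient has_derivative gradient_deriv q) (at q)"
proof -
  have "((\<lambda>q. \<chi> i. - frechet_derivative neg_J (at q) (axis i 1, 0, 0)) has_derivative
      gradient_deriv q) (at q)"
    by (intro has_derivative_vec_lambda has_derivative_minus
        has_derivative_frechet_derivative(2)[OF twice_differentiable_on_neg_J assms])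
  then show ?thesis
    by (rule has_derivative_transform_within_open[OF _ open_dom(3) assms]) (simp add: grad_J_eq)
qed

text \<open>The Hessian and the two mixed partials are blocks of one linear map, the joint
  derivative of the gradient of J; each is extracted by the chain rule along the embedding that
  varies a single argument.\<close>

lemma gradient_partials:
  assumes q: "(\<theta>, l, g) \<in> U \<times> W"
  shows "hess_J M \<theta> l g *v w = gradient_deriv (\<theta>, l, g) (w, 0, 0)"
    and "vector_derivative (\<lambda>l'. grad_J M \<theta> l' g) (at l) = gradient_deriv (\<theta>, l, g) (0, 1, 0)"
    and "vector_derivative (\<lambda>g'. grad_J M \<theta> l g') (at g) = gradient_deriv (\<theta>, l, g) (0, 0, 1)"
proof -
  have lin: "linear (gradient_deriv (\<theta>, l, g))"
    using has_derivative_gradient[OF q] by (rule has_derivative_linear)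
  have "((\<lambda>\<theta>'. (\<theta>', l, g)) has_derivative (\<lambda>w. (w, 0, 0))) (at \<theta>)"
    by (intro has_derivative_Pair has_derivative_ident has_derivative_const)
  from has_derivative_compose[OF this has_derivative_gradient[OF q]]
  have "((\<lambda>\<theta>'. grad_J M \<theta>' l g) has_derivative (\<lambda>w. gradient_deriv (\<theta>, l,
      g) (w, 0, 0))) (at \<theta>)"
    by simp
  then show "hess_J M \<theta> l g *v w = gradient_deriv (\<theta>, l, g) (w, 0, 0)"
    unfolding hess_J_def jacobian_def
    by (simp add: frechet_derivative_at[symmetric] matrix_works has_derivative_linear)
  have "((\<lambda>l'. (\<theta>, l', g)) has_derivative (\<lambda>a. a *\<^sub>R (0, 1, 0))) (at l)"
    by (auto intro!: derivative_eq_intros)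
  from has_derivative_compose[OF this has_derivative_gradient[OF q]]
  have "((\<lambda>l'. grad_J M \<theta> l' g) has_vector_derivative gradient_deriv (\<theta>, l, g) (0, 1, 0))
      (at l)"
    unfolding has_vector_derivative_def linear_scale[OF lin] by simp
  then show "vector_derivative (\<lambda>l'. grad_J M \<theta> l' g) (at l) = gradient_deriv (\<theta>, l, g)
      (0, 1, 0)"
    by (rule vector_derivative_at)
  have "((\<lambda>g'. (\<theta>, l, g')) has_derivative (\<lambda>a. a *\<^sub>R (0, 0, 1))) (at g)"
    by (auto intro!: derivative_eq_intros)
  from has_derivative_compose[OF this has_derivative_gradient[OF q]]
  have "((\<lambda>g'. grad_J M \<theta> l g') has_vector_derivative gradient_deriv (\<theta>, l, g) (0, 0, 1))
      (at g)"
    unfolding has_vector_derivative_def linear_scale[OF lin] by simp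
  then show "vector_derivative (\<lambda>g'. grad_J M \<theta> l g') (at g) = gradient_deriv (\<theta>, l, g)
      (0, 0, 1)"
    by (rule vector_derivative_at)
qed

abbreviation loss_deriv :: "(real^'n) \<times> real \<times> real \<Rightarrow> (real^'n) \<times> real
    \<times> real \<Rightarrow> real" where
  "loss_deriv q v \<equiv> - frechet_derivative (\<lambda>q. frechet_derivative neg_J (at q) (0, 0, 1)) (at q) v"

lemma has_derivative_class_loss:
  assumes "q \<in> U \<times> W"
  shows "((\<lambda>q. class_loss M (fst q) (fst (snd q)) (snd (snd q))) has_derivative loss_deriv q) (at q)"
  by (rule has_derivative_transform_within_open[OF has_derivative_minus[OF
        has_derivative_frechet_derivative(2)[OF twice_differentiable_on_neg_J assms]] open_dom(3) assms])
    (auto simp: class_loss_eq)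

lemma C_lam_eq:
  assumes "(\<theta>, l, g) \<in> U \<times> W"
  shows "C_lam M \<theta> l g = loss_deriv (\<theta>, l, g) (theta_lam M \<theta> l g, 1, 0)"
proof -
  \<comment> \<open>The factors 1 and 0 present the partial derivative of H in the shape of
    \<open>loss_coeff_eq\<close> with a = 1 and b = 0.\<close>
  have "deriv (\<lambda>l'. hamiltonian M z x \<theta> l' g) l =
      - (1 * ln (decoder M \<theta> x z) + 0 * log_class M z x \<theta>)" for z x
    unfolding hamiltonian_def by (rule DERIV_imp_deriv) (auto intro!: derivative_eq_intros)
  then show ?thesis
    unfolding C_lam_def by (simp only: loss_coeff_eq[OF assms])
qed

lemma C_gam_eq:
  assumes "(\<theta>, l, g) \<in> U \<times> W"
  shows "C_gam M \<theta> l g = loss_deriv (\<theta>, l, g) (theta_gam M \<theta> l g, 0, 1)"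
proof -
  have "deriv (\<lambda>g'. hamiltonian M z x \<theta> l g') g =
      - (0 * ln (decoder M \<theta> x z) + 1 * log_class M z x \<theta>)" for z x
    unfolding hamiltonian_def log_class_def by (rule DERIV_imp_deriv) (auto intro!: derivative_eq_intros)
  then show ?thesis
    unfolding C_gam_def by (simp only: loss_coeff_eq[OF assms])
qed

section \<open>Velocities along a path of parameters and multipliers\<close>

context
  fixes lam gam :: "real \<Rightarrow> real" and th :: "real \<Rightarrow> real^'n" and t :: real
    and dlam dgam :: real and dth :: "real^'n"
  assumes dom: "(th t, lam t, gam t) \<in> U \<times> W"
    and path: "(lam has_real_derivative dlam) (at t)" "(gam has_real_derivative dgam) (at t)"
      "(th has_vector_derivative dth) (at t)"
begin

lemma has_derivative_path:
  "((\<lambda>s. (th s, lam s, gam s)) has_derivative (\<lambda>h. h *\<^sub>R (dth, dlam, dgam))) (at t)"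
  using path
  by (auto intro!: derivative_eq_intros simp: has_vector_derivative_def has_field_derivative_def mult.commute)

text \<open>The chain rule turns stationarity of the gradient into the linear equation A \<theta>' +
  \<lambda>' L + \<gamma>' G = 0, with L and G the mixed partials of the gradient of J. Applying the
  inverse of A solves it for \<theta>'.\<close>

lemma quasi_static_velocity:
  assumes inv: "invertible (hess_J M (th t) (lam t) (gam t))"
    and quasi_static: "((\<lambda>s. grad_J M (th s) (lam s) (gam s)) has_vector_derivative 0) (at t)"
  shows "dth = dlam *\<^sub>R theta_lam M (th t) (lam t) (gam t) + dgam *\<^sub>R theta_gam M (th t) (lam t) (gam t)"
proof -
  let ?q = "(th t, lam t, gam t)" and ?A = "hess_J M (th t) (lam t) (gam t)"
  have lin: "linear (gradient_deriv ?q)"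
    using has_derivative_gradient[OF dom] by (rule has_derivative_linear)
  from has_derivative_compose[OF has_derivative_path has_derivative_gradient[OF dom]]
  have "((\<lambda>s. grad_J M (th s) (lam s) (gam s)) has_vector_derivative gradient_deriv ?q (dth, dlam,
      dgam)) (at t)"
    unfolding has_vector_derivative_def linear_scale[OF lin] by simp
  \<comment> \<open>The same curve has derivative 0 by the quasi-static condition, and derivatives
    are unique.\<close>
  then have "0 = gradient_deriv ?q (dth, dlam, dgam)"
    using quasi_static by (rule vector_derivative_unique_at[symmetric])
  also have "(dth, dlam, dgam) = (dth, 0, 0) + dlam *\<^sub>R (0, 1, 0) + dgam *\<^sub>R (0, 0, 1)"
    by simp
  also have "gradient_deriv ?q \<dots> = ?A *v dth
      + dlam *\<^sub>R vector_derivative (\<lambda>l'. grad_J M (th t) l' (gam t)) (at (lam t))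
      + dgam *\<^sub>R vector_derivative (\<lambda>g'. grad_J M (th t) (lam t) g') (at (gam t))"
    (is "_ = _ + _ *\<^sub>R ?l + _ *\<^sub>R ?g")
    by (simp only: linear_add[OF lin] linear_scale[OF lin] gradient_partials[OF dom])
  finally have "?A *v dth = - (dlam *\<^sub>R ?l + dgam *\<^sub>R ?g)"
    by (intro eq_neg_iff_add_eq_0[THEN iffD2]) (simp add: add.assoc)
  then have "matrix_inv ?A *v (?A *v dth) = matrix_inv ?A *v (- (dlam *\<^sub>R ?l + dgam *\<^sub>R ?g))"
    by simp
  then show ?thesis
    by (simp add: matrix_inv_mult_vector[OF inv] theta_lam_def theta_gam_def
        linear_neg[OF matrix_vector_mul_linear] linear_diff[OF matrix_vector_mul_linear]
        linear_scale[OF matrix_vector_mul_linear])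
qed

lemma iso_classification_velocity:
  assumes vel: "dth = dlam *\<^sub>R theta_lam M (th t) (lam t) (gam t) + dgam *\<^sub>R theta_gam M (th t)
      (lam t) (gam t)"
    and iso: "((\<lambda>s. class_loss M (th s) (lam s) (gam s)) has_real_derivative 0) (at t)"
  shows "0 = C_lam M (th t) (lam t) (gam t) * dlam + C_gam M (th t) (lam t) (gam t) * dgam"
proof -
  let ?q = "(th t, lam t, gam t)"
  have lin: "linear (loss_deriv ?q)"
    using has_derivative_class_loss[OF dom] by (rule has_derivative_linear)
  from has_derivative_compose[OF has_derivative_path has_derivative_class_loss[OF dom]]
  have "((\<lambda>s. class_loss M (th s) (lam s) (gam s)) has_vector_derivative loss_deriv ?q (dth, dlam,
      dgam)) (at t)"
    unfolding has_vector_derivative_def linear_scale[OF lin] by simp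
  then have "0 = loss_deriv ?q (dth, dlam, dgam)"
    using iso unfolding has_real_derivative_iff_has_vector_derivative by (rule vector_derivative_unique_at[symmetric])
  \<comment> \<open>Inserting the velocity of \<theta> regroups the direction of motion into the two
    directions at which the loss derivative equals \<open>C_lam\<close> and
    \<open>C_gam\<close>.\<close>
  also have "(dth, dlam, dgam) = dlam *\<^sub>R (theta_lam M (th t) (lam t) (gam t), 1, 0)
      + dgam *\<^sub>R (theta_gam M (th t) (lam t) (gam t), 0, 1)"
    by (simp add: vel)
  also have "loss_deriv ?q \<dots> = dlam *\<^sub>R C_lam M (th t) (lam t) (gam t) + dgam *\<^sub>R C_gam M (th
      t) (lam t) (gam t)"
    by (simp only: linear_add[OF lin] linear_scale[OF lin] C_lam_eq[OF dom] C_gam_eq[OF dom])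
  finally show ?thesis by (simp add: mult.commute)
qed

end

end

lemma smooth_on_imp_differentiable:
  assumes "smooth_on S f" "x \<in> S"
  shows "f differentiable (at x)"
  using spec[OF assms(1)[unfolded smooth_on_def], of "Suc 0"] assms(2) by simp

theorem mainTheorem3:
  fixes M :: "('x, 'y, 'z, 'n::finite) latent_model"
    and U :: "(real^'n) set" and W :: "(real \<times> real) set"
    and T :: "real set"
    and lam gam :: "real \<Rightarrow> real" and th :: "real \<Rightarrow> real^'n"
  assumes "density_model M U" and "regular_model M U W" and "equilibrium_model M W"
    and "open T" and "is_interval T"
    and "smooth_on T lam" and "smooth_on T gam" and "smooth_on T th"
    and "\<And>t. t \<in> T \<Longrightarrow> (lam t, gam t) \<in> W"
    and "\<And>t. t \<in> T \<Longrightarrow> th t \<in> equilibrium M (lam t) (gam t)"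
    and "\<And>t. t \<in> T \<Longrightarrow> invertible (hess_J M (th t) (lam t) (gam t))"
    and quasi_static: "\<And>t. t \<in> T \<Longrightarrow>
      ((\<lambda>s. grad_J M (th s) (lam s) (gam s)) has_vector_derivative 0) (at t)"
    and iso_classification: "\<And>t. t \<in> T \<Longrightarrow>
      ((\<lambda>s. class_loss M (th s) (lam s) (gam s)) has_real_derivative 0) (at t)"
  shows "\<forall>t\<in>T.
      0 = C_lam M (th t) (lam t) (gam t) * deriv lam t
        + C_gam M (th t) (lam t) (gam t) * deriv gam t \<and>
      vector_derivative th (at t) =
        deriv lam t *\<^sub>R theta_lam M (th t) (lam t) (gam t)
        + deriv gam t *\<^sub>R theta_gam M (th t) (lam t) (gam t)"
proof
  fix t assume t: "t \<in> T"
  \<comment> \<open>The equilibrium point \<open>th t\<close> lies in \<open>params M\<close> and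
    thus witnesses that the parameter set is nonempty.\<close>
  interpret regular_latent_model M U W
    using assms(1,2,10) t by unfold_locales (auto simp: equilibrium_def)
  have dom: "(th t, lam t, gam t) \<in> U \<times> W"
    using assms(9,10)[OF t] params_subset by (auto simp: equilibrium_def)
  have path: "(lam has_real_derivative deriv lam t) (at t)" "(gam has_real_derivative deriv gam t) (at t)"
    "(th has_vector_derivative vector_derivative th (at t)) (at t)"
    using smooth_on_imp_differentiable[OF assms(6) t] smooth_on_imp_differentiable[OF assms(7) t]
      smooth_on_imp_differentiable[OF assms(8) t]
    by (simp_all add: DERIV_deriv_iff_real_differentiable vector_derivative_works)
  note vel = quasi_static_velocity[where th = th, OF dom path assms(11)[OF t] quasi_static[OF t]]
  show "0 = C_lam M (th t) (lam t) (gam t) * deriv lam t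
        + C_gam M (th t) (lam t) (gam t) * deriv gam t \<and>
      vector_derivative th (at t) =
        deriv lam t *\<^sub>R theta_lam M (th t) (lam t) (gam t)
        + deriv gam t *\<^sub>R theta_gam M (th t) (lam t) (gam t)"
    using iso_classification_velocity[where th = th, OF dom path vel iso_classification[OF t]] vel by blast
qed

end
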